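(* Let $\mathcal B$ be a homothecy invariant Busemann--Feller basis on $\mathbb R^n$. Then the following claims are equivalent. (1) $\mathcal B$ is a density basis, that is, for every measurable $A\subset\mathbb R^n$, \[\lim_{\mathcal B\ni B\to x}\frac{|A\cap B|}{|B|}=\chi_A(x)\] for almost every $x\in\mathbb R^n$. (2) For every $0<\gamma<1$ and $f\in L^0(\mathbb R^n)$, \[\lim_{\mathcal B\ni B\to x}m^\gamma_f(B)=f(x)\] for almost every $x\in\mathbb R^n$. (3) For every $0<\gamma<1$, there exists a constant $C$ such that \[|\{x\in\mathbb R^n:\mathcal M^\gamma_{\mathcal B} f(x)>\lambda\}|\le C|\{x\in\mathbb R^n:|f(x)|>\lambda\}|\] for every $\lambda>0$ and $f\in L^0(\mathbb R^n)$. (4) For every $0<\gamma<1$ and $0<p<\infty$, there exists a constant $C$ such that \[\|\mathcal M^\gamma_{\mathcal B} f\|_{L^p(\mathbb R^n)}\le C\|f\|_{L^p(\mathbb R^n)}\] for every $f\in L^p(\mathbb R^n)$. (5) There exists $0<p<\infty$ such that, for every $0<\gamma<1$, every $\lambda>0$ and every sequence $(f_k)_{k\in\mathbb N}$ in $L^p(\mathbb R^n)$ such that $\|f_k\|_{L^p(\mathbb R^n)}\to0$ as $k\to\infty$, we have \[|\{x\in\mathbb R^n:\mathcal M^\gamma_{\mathcal B} f_k(x)>\lambda\}|\to0\quad\text{as }k\to\infty.\] (6) There exists $0<p<\infty$ such that, for every $0<\gamma<1$ and $f\in L^p(\mathbb R^n)$, \[\mathcal M^\gamma_{\mathcal B}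 f(x)<\infty\] for almost every $x\in\mathbb R^n$.
   Context: $|A|$ denotes Lebesgue measure of $A\subset\mathbb R^n$, and "measurable" and "almost every" refer to Lebesgue measure. $L^0(\mathbb R^n)$ is the set of measurable $f:\mathbb R^n\to[-\infty,\infty]$ with $|f(x)|<\infty$ for almost every $x$. For $0<p<\infty$, $\|f\|_{L^p(\mathbb R^n)}=(\int|f|^p)^{1/p}$ (a quasi-norm if $p<1$). $\chi_A$ is the characteristic function of $A$. A differentiation basis on $\mathbb R^n$ is a collection $\mathcal B=\bigcup_{x\in\mathbb R^n}\mathcal B(x)$, where each $\mathcal B(x)$ consists of bounded measurable sets containing $x$ and, for every $x$ and $\varepsilon>0$, there is $B\in\mathcal B(x)$ with $\operatorname{diam}(B)<\varepsilon$. It is a Busemann--Feller basis if each $B\in\mathcal B$ is open and $x\in B\in\mathcal B$ implies $B\in\mathcal B(x)$. It is homothecy invariant if $B\in\mathcal B$ implies $B'\in\mathcal B$ for every $B'$ homothetic to $B$ (i.e. $B'=a+tB$ with $a\in\mathbb R^n$, $t>0$). For a set function $\varphi$ on $\mathcal B$, $\limsup_{\mathcal B\ni B\to x}\varphi(B)=\lim_{\varepsilon\to0}\sup\{\varphi(B):B\in\mathcal B(x),\ \operatorname{diam}(B)<\varepsilon\}$; $\liminf$ is defined with $\inf$ in place of $\sup$; $\lim_{\mathcal B\ni B\to x}\varphi(B)$ is the common value if they coincide. For $0<\gamma<1$, a measurable function $f$ and a bounded measurable set $A$, the $\gamma$-median is $m^\gamma_f(A)=\inf\{a\in\mathbb R:|\{x\in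 A:f(x)>a\}|<\gamma|A|\}$. The median maximal function is $\mathcal M^\gamma_{\mathcal B}f(x)=\sup_{x\in B\in\mathcal B}m^\gamma_{|f|}(B)$. *)

theory Defs
  imports "HOL-Analysis.Analysis"
begin

section \<open>Differentiation bases\<close>

text \<open>A basis is given by the map \<open>x \<mapsto> \<B> x\<close>; as a collection of sets it is
  \<open>basis_sets \<B>\<close>, the union of all \<open>\<B> x\<close>.\<close>

definition basis_sets :: "('a \<Rightarrow> 'a set set) \<Rightarrow> 'a set set" where
  "basis_sets \<B> = (\<Union>x. \<B> x)"

definition differentiation_basis :: "('a::euclidean_space \<Rightarrow> 'a set set) \<Rightarrow> bool" where
  "differentiation_basis \<B> \<longleftrightarrow>
     (\<forall>x. (\<forall>B\<in>\<B> x. bounded B \<and> B \<in> sets lebesgue \<and> x \<in> B) \<and>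
          (\<forall>\<epsilon>>0. \<exists>B\<in>\<B> x. diameter B < \<epsilon>))"

definition busemann_feller_basis :: "('a::euclidean_space \<Rightarrow> 'a set set) \<Rightarrow> bool" where
  "busemann_feller_basis \<B> \<longleftrightarrow>
     differentiation_basis \<B> \<and>
     (\<forall>B\<in>basis_sets \<B>. open B \<and> (\<forall>x\<in>B. B \<in> \<B> x))"

definition homothecy_invariant :: "('a::euclidean_space \<Rightarrow> 'a set set) \<Rightarrow> bool" where
  "homothecy_invariant \<B> \<longleftrightarrow>
     (\<forall>B\<in>basis_sets \<B>. \<forall>a. \<forall>t>0. (\<lambda>y. a + t *\<^sub>R y) ` B \<in> basis_sets \<B>)"

section \<open>Limits along a basis\<close>

definition basis_limsup ::
  "('a::euclidean_space \<Rightarrow> 'a set set) \<Rightarrow> ('a set \<Rightarrow> ereal) \<Rightarrow> 'a \<Rightarrow> ereal" where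
  "basis_limsup \<B> \<phi> x =
     Lim (at_right 0) (\<lambda>\<epsilon>::real. SUP B\<in>{B\<in>\<B> x. diameter B < \<epsilon>}. \<phi> B)"

definition basis_liminf ::
  "('a::euclidean_space \<Rightarrow> 'a set set) \<Rightarrow> ('a set \<Rightarrow> ereal) \<Rightarrow> 'a \<Rightarrow> ereal" where
  "basis_liminf \<B> \<phi> x =
     Lim (at_right 0) (\<lambda>\<epsilon>::real. INF B\<in>{B\<in>\<B> x. diameter B < \<epsilon>}. \<phi> B)"

definition has_basis_limit ::
  "('a::euclidean_space \<Rightarrow> 'a set set) \<Rightarrow> ('a set \<Rightarrow> ereal) \<Rightarrow> 'a \<Rightarrow> ereal \<Rightarrow> bool" where
  "has_basis_limit \<B> \<phi> x L \<longleftrightarrow> basis_limsup \<B> \<phi> x = L \<and> basis_liminf \<B> \<phi> x = L"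

text \<open>The one-sided limits in the two definitions above always exist, by monotonicity in \<open>\<epsilon>\<close>:\<close>

lemma basis_limsup_eq_INF:
  "basis_limsup \<B> \<phi> x = (INF \<epsilon>\<in>{0::real<..}. SUP B\<in>{B\<in>\<B> x. diameter B < \<epsilon>}. \<phi> B)"
proof -
  let ?s = "\<lambda>\<epsilon>::real. SUP B\<in>{B\<in>\<B> x. diameter B < \<epsilon>}. \<phi> B"
  have mono: "?s d \<le> ?s e" if "d \<le> e" for d e
    using that by (intro SUP_subset_mono) auto
  have "(?s \<longlongrightarrow> (INF \<epsilon>\<in>{0<..}. ?s \<epsilon>)) (at_right 0)"
  proof (rule order_tendstoI)
    fix a assume "a < (INF \<epsilon>\<in>{0<..}. ?s \<epsilon>)"
    then have "a < ?s e" if "e > 0" for e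
      using that by (meson INF_lower greaterThan_iff less_le_trans)
    then show "\<forall>\<^sub>F e in at_right 0. a < ?s e"
      by (auto simp: eventually_at_right_field intro!: exI[of _ 1])
  next
    fix a assume "(INF \<epsilon>\<in>{0<..}. ?s \<epsilon>) < a"
    then obtain e where "e > 0" "?s e < a"
      by (auto simp: INF_less_iff)
    then have "?s d < a" if "d < e" for d
      using le_less_trans[OF mono[of d e]] that by simp
    with \<open>e > 0\<close> show "\<forall>\<^sub>F e in at_right 0. ?s e < a"
      unfolding eventually_at_right_field by blast
  qed
  then show ?thesis
    unfolding basis_limsup_def by (intro tendsto_Lim) auto
qed

lemma basis_liminf_eq_SUP:
  "basis_liminf \<B> \<phi> x = (SUP \<epsilon>\<in>{0::real<..}. INF B\<in>{B\<in>\<B> x. diameter B < \<epsilon>}. \<phi> B)"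
proof -
  let ?s = "\<lambda>\<epsilon>::real. INF B\<in>{B\<in>\<B> x. diameter B < \<epsilon>}. \<phi> B"
  have mono: "?s e \<le> ?s d" if "d \<le> e" for d e
    using that by (intro INF_superset_mono) auto
  have "(?s \<longlongrightarrow> (SUP \<epsilon>\<in>{0<..}. ?s \<epsilon>)) (at_right 0)"
  proof (rule order_tendstoI)
    fix a assume "(SUP \<epsilon>\<in>{0<..}. ?s \<epsilon>) < a"
    then have "?s e < a" if "e > 0" for e
      using that by (meson SUP_upper greaterThan_iff le_less_trans)
    then show "\<forall>\<^sub>F e in at_right 0. ?s e < a"
      by (auto simp: eventually_at_right_field intro!: exI[of _ 1])
  next
    fix a assume "a < (SUP \<epsilon>\<in>{0<..}. ?s \<epsilon>)"
    then obtain e where "e > 0" "a < ?s e"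
      by (auto simp: less_SUP_iff)
    then show "\<forall>\<^sub>F e in at_right 0. a < ?s e"
      unfolding eventually_at_right_field
      by (intro exI[of _ e]) (auto intro: less_le_trans[OF _ mono])
  qed
  then show ?thesis
    unfolding basis_liminf_def by (intro tendsto_Lim) auto
qed

definition density_basis :: "('a::euclidean_space \<Rightarrow> 'a set set) \<Rightarrow> bool" where
  "density_basis \<B> \<longleftrightarrow>
     (\<forall>A\<in>sets lebesgue. AE x in lebesgue.
        has_basis_limit \<B> (\<lambda>B. ereal (measure lebesgue (A \<inter> B) / measure lebesgue B))
          x (indicator A x))"

section \<open>Function spaces\<close>

definition L0 :: "('a::euclidean_space \<Rightarrow> ereal) set" where
  "L0 = {f \<in> borel_measurable lebesgue. AE x in lebesgue. \<bar>f x\<bar> < \<infinity>}"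

text \<open>Powers on \<open>[0,\<infinity>]\<close> with real exponent, meant for \<open>p > 0\<close> only.\<close>

definition ennreal_powr :: "ennreal \<Rightarrow> real \<Rightarrow> ennreal" where
  "ennreal_powr t p = (if t = \<infinity> then \<infinity> else ennreal (enn2real t powr p))"

definition Lp_norm :: "real \<Rightarrow> ('a::euclidean_space \<Rightarrow> ereal) \<Rightarrow> ennreal" where
  "Lp_norm p f =
     ennreal_powr (\<integral>\<^sup>+x. ennreal_powr (e2ennreal \<bar>f x\<bar>) p \<partial>lebesgue) (1 / p)"

definition Lp :: "real \<Rightarrow> ('a::euclidean_space \<Rightarrow> ereal) set" where
  "Lp p = {f \<in> borel_measurable lebesgue. Lp_norm p f < \<infinity>}"

section \<open>Medians and the median maximal function\<close>

definition median :: "real \<Rightarrow> ('a::euclidean_space \<Rightarrow> ereal) \<Rightarrow> 'a set \<Rightarrow> ereal" where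
  "median \<gamma> f A =
     Inf (ereal ` {a::real. emeasure lebesgue {x\<in>A. f x > ereal a}
                              < ennreal \<gamma> * emeasure lebesgue A})"

definition median_maximal ::
  "real \<Rightarrow> ('a::euclidean_space \<Rightarrow> 'a set set) \<Rightarrow> ('a \<Rightarrow> ereal) \<Rightarrow> 'a \<Rightarrow> ereal" where
  "median_maximal \<gamma> \<B> f x =
     (SUP B\<in>{B\<in>basis_sets \<B>. x \<in> B}. median \<gamma> (\<lambda>y. \<bar>f y\<bar>) B)"

text \<open>The library measure gives non-measurable sets the value 0, so we record that the
  superlevel sets below are genuinely measurable.\<close>

lemma open_median_maximal_superlevel:
  assumes "busemann_feller_basis \<B>"
  shows "open {x. median_maximal \<gamma> \<B> f x > c}"
proof -
  have "{x. median_maximal \<gamma> \<B> f x > c} =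
        \<Union>{B\<in>basis_sets \<B>. median \<gamma> (\<lambda>y. \<bar>f y\<bar>) B > c}"
    by (auto simp: median_maximal_def less_SUP_iff)
  then show ?thesis
    using assms by (auto simp: busemann_feller_basis_def)
qed

end

theory Submission
  imports Defs
begin

text \<open>
  Apart from the differentiation of medians, all conditions are compared with one geometric statement
  about sets, the Tauberian condition: for every \<open>0 < \<gamma> < 1\<close> the union of all \<open>B \<in> \<B>\<close> in which \<open>A\<close> occupies at least the portion
  \<open>\<gamma>\<close>, called the halo of \<open>A\<close>, has measure at most \<open>C\<close> times that of \<open>A\<close>.  The median exceeds \<open>\<lambda>\<close> on \<open>B\<close>
  only if \<open>{\<bar>f\<bar> > \<lambda>}\<close> occupies at least the portion \<open>\<gamma>\<close> of \<open>B\<close>, so the superlevel sets of the median maximal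
  function lie in the halos of the superlevel sets of \<open>\<bar>f\<bar>\<close>, and for multiples of indicator
  functions they exhaust these halos.  This translates the Tauberian condition into
  the weak type estimate, the layer cake formula integrates it to the strong type estimate for
  every exponent, and the latter, for \<open>p = 1\<close>, gives the two qualitative conditions by Markov's
  inequality.

  The way back from the qualitative conditions, and from the density condition, uses homothecy
  invariance.  For convergence in measure a dilation suffices (\<open>small_sets_imp_tauberian\<close>).  For the
  other two, failure of the Tauberian condition provides sets that are arbitrarily small compared with
  their halos.Suitably chosen translates of a subset \<open>K\<close> of the unit ball,
  with total measure at most an absolute constant, cover half of that ball, provided that \<open>K\<close> has
  positive measure (\<open>translates_cover_half_ball\<close>); translates of a subset \<open>K\<close> of the unit ball cover half of the unit ball with
  total measure at most an absolute constant
  (\<open>translates_cover_half_ball\<close>); applied to shrunken halos, this yields sets \<open>E k\<close> of prescribed small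
  measure whose halos, formed by sets of \<open>\<B>\<close> of diameter tending
  to 0, cover half of the ball (\<open>not_tauberian_bad_sequence\<close>).
  Their union then contradicts the density condition, and a function that grows on the \<open>E k\<close> contradicts
  almost everywhere finiteness.  Conversely the Tauberian condition gives the density condition by
  enclosing sets in slightly larger open sets (\<open>tauberian_imp_density_basis\<close>).

  The differentiation of medians is equivalent to the density condition by looking at the superlevel
  sets of \<open>f\<close> at rational heights, and at indicator functions.
\<close>

section \<open>Limits along a basis as filter limits\<close>

text \<open>The contraction of the sets of \<open>\<B> x\<close> to \<open>x\<close> as a filter: limits along \<open>\<B>\<close> become ordinary
limits, and statements about all sufficiently small \<open>B\<close> can be combined.\<close>

definition basis_filter :: "('a::euclidean_space \<Rightarrow> 'a set set) \<Rightarrow> 'a \<Rightarrow> 'a set filter" where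
  "basis_filter \<B> x = (INF \<epsilon>\<in>{0::real<..}. principal {B\<in>\<B> x. diameter B < \<epsilon>})"

lemma eventually_basis_filter:
  "eventually P (basis_filter \<B> x) \<longleftrightarrow> (\<exists>\<epsilon>>0. \<forall>B\<in>\<B> x. diameter B < \<epsilon> \<longrightarrow> P B)"
  unfolding basis_filter_def
proof (subst eventually_INF_base)
  fix a b :: real assume "a \<in> {0<..}" "b \<in> {0<..}"
  then show "\<exists>e\<in>{0<..}. principal {B \<in> \<B> x. diameter B < e}
      \<le> inf (principal {B \<in> \<B> x. diameter B < a}) (principal {B \<in> \<B> x. diameter B < b})"
    by (intro bexI[of _ "min a b"]) auto
qed (auto simp: eventually_principal)

lemma eventually_in_basis: "\<forall>\<^sub>F B in basis_filter \<B> x. B \<in> \<B> x"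
  unfolding eventually_basis_filter by (intro exI[of _ 1]) auto

text \<open>A limit along the filter forces the upper limit to be at most and the lower limit to be at least
\<open>L\<close>.  That the lower limit does not exceed the upper one needs arbitrarily small sets in every
\<open>\<B> x\<close>; otherwise the infimum over the empty set would be infinite.\<close>

lemma has_basis_limit_iff_tendsto:
  assumes "differentiation_basis \<B>"
  shows "has_basis_limit \<B> \<phi> x L \<longleftrightarrow> (\<phi> \<longlongrightarrow> L) (basis_filter \<B> x)"
proof
  assume lim: "has_basis_limit \<B> \<phi> x L"
  show "(\<phi> \<longlongrightarrow> L) (basis_filter \<B> x)"
  proof (rule order_tendstoI)
    fix a assume "a < L"
    then have "a < (SUP \<epsilon>\<in>{0::real<..}. INF B\<in>{B\<in>\<B> x. diameter B < \<epsilon>}. \<phi> B)"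
      using lim by (simp add: has_basis_limit_def basis_liminf_eq_SUP)
    then obtain \<epsilon> :: real where "\<epsilon> > 0" "a < (INF B\<in>{B\<in>\<B> x. diameter B < \<epsilon>}. \<phi> B)"
      by (auto simp: less_SUP_iff)
    then show "\<forall>\<^sub>F B in basis_filter \<B> x. a < \<phi> B"
      unfolding eventually_basis_filter by (blast intro: less_INF_D)
  next
    fix a assume "L < a"
    then have "(INF \<epsilon>\<in>{0::real<..}. SUP B\<in>{B\<in>\<B> x. diameter B < \<epsilon>}. \<phi> B) < a"
      using lim by (simp add: has_basis_limit_def basis_limsup_eq_INF)
    then obtain \<epsilon> :: real where "\<epsilon> > 0" "(SUP B\<in>{B\<in>\<B> x. diameter B < \<epsilon>}. \<phi> B) < a"
      by (auto simp: INF_less_iff)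
    then show "\<forall>\<^sub>F B in basis_filter \<B> x. \<phi> B < a"
      unfolding eventually_basis_filter by (blast intro: SUP_lessD)
  qed
next
  assume lim: "(\<phi> \<longlongrightarrow> L) (basis_filter \<B> x)"
  have "basis_limsup \<B> \<phi> x \<le> L"
  proof (rule dense_ge)
    fix a assume "L < a"
    then obtain \<epsilon> where \<epsilon>: "\<epsilon> > 0" "\<forall>B\<in>\<B> x. diameter B < \<epsilon> \<longrightarrow> \<phi> B < a"
      using order_tendstoD(2)[OF lim] unfolding eventually_basis_filter by blast
    then show "basis_limsup \<B> \<phi> x \<le> a"
      unfolding basis_limsup_eq_INF by (intro INF_lower2[of \<epsilon>] SUP_least) (auto intro: less_imp_le)
  qed
  moreover have "L \<le> basis_liminf \<B> \<phi> x"
  proof (rule dense_le)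
    fix a assume "a < L"
    then obtain \<epsilon> where \<epsilon>: "\<epsilon> > 0" "\<forall>B\<in>\<B> x. diameter B < \<epsilon> \<longrightarrow> a < \<phi> B"
      using order_tendstoD(1)[OF lim] unfolding eventually_basis_filter by blast
    then show "a \<le> basis_liminf \<B> \<phi> x"
      unfolding basis_liminf_eq_SUP by (intro SUP_upper2[of \<epsilon>] INF_greatest) (auto intro: less_imp_le)
  qed
  moreover have "basis_liminf \<B> \<phi> x \<le> basis_limsup \<B> \<phi> x"
    unfolding basis_limsup_eq_INF basis_liminf_eq_SUP
  proof (intro SUP_least INF_greatest)
    fix d e :: real assume "d \<in> {0<..}" "e \<in> {0<..}"
    then have "0 < min d e" by simp
    then obtain B where "B \<in> \<B> x" "diameter B < min d e"
      using assms unfolding differentiation_basis_def by meson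
    then show "(INF B\<in>{B\<in>\<B> x. diameter B < d}. \<phi> B) \<le> (SUP B\<in>{B\<in>\<B> x. diameter B < e}. \<phi> B)"
      by (intro INF_lower2[of B] SUP_upper) auto
  qed
  ultimately show "has_basis_limit \<B> \<phi> x L"
    unfolding has_basis_limit_def by auto
qed

section \<open>Sets of a Busemann--Feller basis\<close>

definition rel_density :: "'a::euclidean_space set \<Rightarrow> 'a set \<Rightarrow> real" where
  "rel_density A B = measure lebesgue (A \<inter> B) / measure lebesgue B"

lemma open_in_sets_lebesgue: "open S \<Longrightarrow> S \<in> sets lebesgue"
  by (simp add: borel_open sets_completionI_sets)

context
  fixes \<B> :: "'a::euclidean_space \<Rightarrow> 'a set set"
  assumes bf: "busemann_feller_basis \<B>"
begin

lemma bf_differentiation_basis: "differentiation_basis \<B>"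
  using bf by (simp add: busemann_feller_basis_def)

lemma basis_set_mem_iff: "B \<in> \<B> x \<longleftrightarrow> B \<in> basis_sets \<B> \<and> x \<in> B"
  using bf unfolding busemann_feller_basis_def differentiation_basis_def basis_sets_def by blast

lemma basis_set:
  assumes "B \<in> basis_sets \<B>"
  shows "open B" "bounded B" "B \<in> lmeasurable" "0 < measure lebesgue B"
proof -
  obtain x where x: "B \<in> \<B> x" "x \<in> B"
    using assms basis_set_mem_iff unfolding basis_sets_def by blast
  show 1: "open B" "bounded B"
    using bf assms x unfolding busemann_feller_basis_def differentiation_basis_def by blast+
  then show 2: "B \<in> lmeasurable"
    by (simp add: lmeasurable_open)
  have "measure lebesgue B \<noteq> 0"
    using x(2) 1 2 open_not_negligible[of B] by (auto simp: negligible_iff_measure)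
  then show "0 < measure lebesgue B"
    by (simp add: less_le)
qed

lemma basis_emeasure:
  assumes "B \<in> basis_sets \<B>" "0 \<le> \<gamma>"
  shows "ennreal \<gamma> * emeasure lebesgue B = ennreal (\<gamma> * measure lebesgue B)"
  using basis_set[OF assms(1)] assms(2) by (simp add: emeasure_eq_measure2 ennreal_mult)

text \<open>Division by the measure of \<open>B\<close> is legitimate because a nonempty bounded open set has positive and
finite measure.  This moves between the extended measures in which medians are phrased and the
real quotients of the density condition.\<close>

lemma rel_density_ge_iff:
  assumes "B \<in> basis_sets \<B>" "A \<in> sets lebesgue" "0 \<le> \<gamma>"
  shows "ennreal \<gamma> * emeasure lebesgue B \<le> emeasure lebesgue (A \<inter> B) \<longleftrightarrow> \<gamma> \<le> rel_density A B"
proof -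
  have "A \<inter> B \<in> lmeasurable"
    using basis_set[OF assms(1)] assms(2) by (metis fmeasurable_Int_fmeasurable inf_commute)
  then show ?thesis
    using basis_set(4)[OF assms(1)]
    by (simp add: basis_emeasure assms emeasure_eq_measure2 rel_density_def field_simps)
qed

lemma rel_density_Compl:
  assumes "B \<in> basis_sets \<B>" "A \<in> sets lebesgue"
  shows "rel_density (- A) B = 1 - rel_density A B"
proof -
  have "A \<inter> B \<in> lmeasurable"
    using basis_set[OF assms(1)] assms(2) by (metis fmeasurable_Int_fmeasurable inf_commute)
  moreover have "- A \<inter> B = B - A \<inter> B"
    by auto
  ultimately have "measure lebesgue (- A \<inter> B) = measure lebesgue B - measure lebesgue (A \<inter> B)"
    using basis_set(3)[OF assms(1)] by (simp add: measurable_measure_Diff)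
  then show ?thesis
    using basis_set(4)[OF assms(1)] by (simp add: rel_density_def diff_divide_distrib)
qed

lemma rel_density_nonneg: "0 \<le> rel_density A B"
  by (simp add: rel_density_def)

section \<open>Density and differentiation of medians\<close>

text \<open>The density condition is symmetric under complements, since the densities of \<open>A\<close> and \<open>- A\<close> in \<open>B\<close>
add up to 1.  So it suffices to control the density of every set at almost every point
\<^emph>\<open>outside\<close> it, and only below each single threshold \<open>\<gamma>\<close>: countably many thresholds tending to 0
cost only a null set.\<close>

lemma density_basisI:
  assumes "\<And>A \<gamma>. A \<in> sets lebesgue \<Longrightarrow> 0 < \<gamma> \<Longrightarrow> \<gamma> < 1 \<Longrightarrow>
     AE x in lebesgue. x \<notin> A \<longrightarrow> (\<forall>\<^sub>F B in basis_filter \<B> x. rel_density A B < \<gamma>)"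
  shows "density_basis \<B>"
  unfolding density_basis_def
proof
  have zero: "AE x in lebesgue. x \<notin> A \<longrightarrow> (rel_density A \<longlongrightarrow> 0) (basis_filter \<B> x)"
    if A: "A \<in> sets lebesgue" for A
  proof -
    have "AE x in lebesgue. \<forall>n. x \<notin> A \<longrightarrow>
        (\<forall>\<^sub>F B in basis_filter \<B> x. rel_density A B < 1 / real (Suc (Suc n)))"
      unfolding AE_all_countable by (intro allI assms A) auto
    then show ?thesis
    proof eventually_elim
      case (elim x)
      show ?case
      proof (intro impI order_tendstoI)
        fix a :: real assume "a < 0"
        then show "\<forall>\<^sub>F B in basis_filter \<B> x. a < rel_density A B"
          using rel_density_nonneg less_le_trans by (intro always_eventually) blast
      next
        fix a :: real assume "x \<notin> A" "0 < a"
        obtain n where "1 / real (Suc n) < a"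
          using \<open>0 < a\<close> nat_approx_posE by blast
        moreover have "1 / real (Suc (Suc n)) \<le> 1 / real (Suc n)"
          by (simp add: field_simps)
        ultimately show "\<forall>\<^sub>F B in basis_filter \<B> x. rel_density A B < a"
          using elim \<open>x \<notin> A\<close> by (auto elim!: allE[of _ n] eventually_mono)
      qed
    qed
  qed
  fix A :: "'a set" assume A: "A \<in> sets lebesgue"
  then have "- A \<in> sets lebesgue"
    by (metis Compl_in_sets_lebesgue)
  from zero[OF A] zero[OF this] show "AE x in lebesgue.
      has_basis_limit \<B> (\<lambda>B. ereal (measure lebesgue (A \<inter> B) / measure lebesgue B)) x (indicator A x)"
  proof eventually_elim
    case (elim x)
    have "(rel_density A \<longlongrightarrow> indicator A x) (basis_filter \<B> x)"
    proof (cases "x \<in> A")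
      case True
      then have "((\<lambda>B. 1 - rel_density (- A) B) \<longlongrightarrow> 1 - 0) (basis_filter \<B> x)"
        using elim by (intro tendsto_intros) auto
      moreover have "\<forall>\<^sub>F B in basis_filter \<B> x. 1 - rel_density (- A) B = rel_density A B"
        using eventually_in_basis by eventually_elim (simp add: basis_set_mem_iff rel_density_Compl A)
      ultimately show ?thesis
        using True by (simp add: tendsto_cong)
    qed (use elim in auto)
    then have "((\<lambda>B. ereal (rel_density A B)) \<longlongrightarrow> ereal (indicator A x)) (basis_filter \<B> x)"
      by simp
    moreover have "ereal (indicator A x) = indicator A x"
      by (simp add: indicator_def)
    ultimately show ?case
      by (simp add: has_basis_limit_iff_tendsto[OF bf_differentiation_basis] rel_density_def
          del: lim_ereal)
  qed
qed

lemma density_basisD: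
  assumes "density_basis \<B>" "A \<in> sets lebesgue" "0 < \<gamma>" "\<gamma> < 1"
  shows "AE x in lebesgue. if x \<in> A then \<forall>\<^sub>F B in basis_filter \<B> x. \<gamma> < rel_density A B
     else \<forall>\<^sub>F B in basis_filter \<B> x. rel_density A B < \<gamma>"
proof -
  have "AE x in lebesgue.
      has_basis_limit \<B> (\<lambda>B. ereal (measure lebesgue (A \<inter> B) / measure lebesgue B)) x (indicator A x)"
    using assms by (simp add: density_basis_def)
  then show ?thesis
  proof eventually_elim
    case (elim x)
    then have "((\<lambda>B. ereal (rel_density A B)) \<longlongrightarrow> indicator A x) (basis_filter \<B> x)"
      by (simp add: has_basis_limit_iff_tendsto[OF bf_differentiation_basis] rel_density_def)
    from order_tendstoD[OF this, of "ereal \<gamma>"] show ?case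
      using assms by simp
  qed
qed

end

lemma less_medianD:
  assumes "ereal a < median \<gamma> f B"
  shows "ennreal \<gamma> * emeasure lebesgue B \<le> emeasure lebesgue {x\<in>B. f x > ereal a}"
proof (rule ccontr)
  assume "\<not> ?thesis"
  then have "median \<gamma> f B \<le> ereal a"
    unfolding median_def by (intro Inf_lower) auto
  with assms show False
    by simp
qed

lemma median_leI:
  assumes "emeasure lebesgue {x\<in>B. f x > ereal a} < ennreal \<gamma> * emeasure lebesgue B"
  shows "median \<gamma> f B \<le> ereal a"
  using assms unfolding median_def by (intro Inf_lower) auto

lemma median_geI:
  assumes "\<And>a. ereal a < c \<Longrightarrow>
    ennreal \<gamma> * emeasure lebesgue B \<le> emeasure lebesgue {x\<in>B. f x > ereal a}"
  shows "c \<le> median \<gamma> f B"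
  unfolding median_def using assms by (force intro!: Inf_greatest simp: not_less[symmetric])

lemma superlevel_in_sets_lebesgue:
  fixes f :: "'a::euclidean_space \<Rightarrow> ereal"
  assumes "f \<in> borel_measurable lebesgue"
  shows "{x. f x > c} \<in> sets lebesgue"
  using borel_measurable_less[of "\<lambda>_. c" lebesgue f] assms by simp

context
  fixes \<B> :: "'a::euclidean_space \<Rightarrow> 'a set set"
  assumes bf: "busemann_feller_basis \<B>"
begin

text \<open>Apply the density condition to the countably many superlevel sets \<open>{f > q}\<close> with \<open>q\<close> rational.  At
a point \<open>x\<close> that is good for all of them, a set \<open>{f > q}\<close> with \<open>q < f x\<close> eventually fills more than
the portion \<open>\<gamma>\<close> of \<open>B\<close>, which pushes the median up to \<open>q\<close>; one with \<open>q > f x\<close> eventually fills less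
than \<open>\<gamma>\<close>, which keeps the median at most \<open>q\<close>.\<close>

lemma density_basis_median_tendsto:
  assumes dens: "density_basis \<B>" and \<gamma>: "0 < \<gamma>" "\<gamma> < 1" and f: "f \<in> L0"
  shows "AE x in lebesgue. has_basis_limit \<B> (median \<gamma> f) x (f x)"
proof -
  have [measurable]: "f \<in> borel_measurable lebesgue" and fin: "AE x in lebesgue. \<bar>f x\<bar> < \<infinity>"
    using f by (auto simp: L0_def)
  let ?A = "\<lambda>q::rat. {x. f x > ereal (of_rat q)}"
  have A: "?A q \<in> sets lebesgue" for q
    by (intro superlevel_in_sets_lebesgue) measurable
  have "AE x in lebesgue. \<forall>q. if x \<in> ?A q
      then \<forall>\<^sub>F B in basis_filter \<B> x. \<gamma> < rel_density (?A q) B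
      else \<forall>\<^sub>F B in basis_filter \<B> x. rel_density (?A q) B < \<gamma>"
    unfolding AE_all_countable by (intro allI density_basisD[OF bf dens A] \<gamma>)
  with fin show ?thesis
  proof eventually_elim
    case (elim x)
    then obtain r where r: "f x = ereal r"
      by (cases "f x") auto
    have set_eq: "{y\<in>B. f y > ereal a} = {y. f y > ereal a} \<inter> B" for a B
      by auto
    have "(median \<gamma> f \<longlongrightarrow> f x) (basis_filter \<B> x)"
    proof (rule order_tendstoI)
      fix a assume a: "a < f x"
      obtain b where b: "a < ereal b" "ereal b < f x"
        using a ereal_dense2 by blast
      then obtain q where q: "b < of_rat q" "of_rat q < r"
        using of_rat_dense r by auto
      then have "\<forall>\<^sub>F B in basis_filter \<B> x. \<gamma> < rel_density (?A q) B"
        using elim(2)[rule_format, of q] r by auto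
      with eventually_in_basis show "\<forall>\<^sub>F B in basis_filter \<B> x. a < median \<gamma> f B"
      proof eventually_elim
        case (elim B)
        then have B: "B \<in> basis_sets \<B>"
          using basis_set_mem_iff[OF bf] by blast
        have "ereal (of_rat q) \<le> median \<gamma> f B"
        proof (rule median_geI)
          fix c assume c: "ereal c < ereal (of_rat q)"
          have "ennreal \<gamma> * emeasure lebesgue B \<le> emeasure lebesgue (?A q \<inter> B)"
            using rel_density_ge_iff[OF bf B A] elim \<gamma> by simp
          also have "\<dots> \<le> emeasure lebesgue {y\<in>B. f y > ereal c}"
            unfolding set_eq using c basis_set(3)[OF bf B]
            by (intro emeasure_mono sets.Int superlevel_in_sets_lebesgue)
              (auto intro: less_trans[of "ereal c" "ereal (of_rat q)"] simp: fmeasurableD)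
          finally show "ennreal \<gamma> * emeasure lebesgue B \<le> emeasure lebesgue {y\<in>B. f y > ereal c}" .
        qed
        then show ?case
          using b q by (meson ereal_less_eq(3) less_le_trans less_imp_le)
      qed
    next
      fix a assume a: "f x < a"
      obtain b where b: "f x < ereal b" "ereal b < a"
        using a ereal_dense2 by blast
      then obtain q where q: "r < of_rat q" "of_rat q < b"
        using of_rat_dense r by auto
      then have "\<forall>\<^sub>F B in basis_filter \<B> x. rel_density (?A q) B < \<gamma>"
        using elim(2)[rule_format, of q] r by auto
      with eventually_in_basis show "\<forall>\<^sub>F B in basis_filter \<B> x. median \<gamma> f B < a"
      proof eventually_elim
        case (elim B)
        then have B: "B \<in> basis_sets \<B>"
          using basis_set_mem_iff[OF bf] by blast
        have "emeasure lebesgue (?A q \<inter> B) < ennreal \<gamma> * emeasure lebesgue B"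
          using rel_density_ge_iff[OF bf B A, of \<gamma> q] elim \<gamma> by (auto simp: not_le[symmetric])
        then have "median \<gamma> f B \<le> ereal (of_rat q)"
          unfolding set_eq[symmetric] by (rule median_leI)
        then show ?case
          using b q by (meson ereal_less_eq(3) le_less_trans less_imp_le)
      qed
    qed
    then show ?case
      by (simp add: has_basis_limit_iff_tendsto[OF bf_differentiation_basis[OF bf]])
  qed
qed

lemma indicator_in_L0: "A \<in> sets lebesgue \<Longrightarrow> (indicator A :: 'a \<Rightarrow> ereal) \<in> L0"
  by (auto simp: L0_def indicator_def)

text \<open>The \<open>\<gamma>\<close>-median of an indicator function on \<open>B\<close> drops below 1 only if the set occupies less than the
portion \<open>\<gamma>\<close> of \<open>B\<close>.\<close>

lemma median_tendsto_imp_density_basis: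
  assumes lim: "\<And>\<gamma> f. 0 < \<gamma> \<Longrightarrow> \<gamma> < 1 \<Longrightarrow> f \<in> L0 \<Longrightarrow>
    AE x in lebesgue. has_basis_limit \<B> (median \<gamma> f) x (f x)"
  shows "density_basis \<B>"
proof (rule density_basisI[OF bf])
  fix A :: "'a set" and \<gamma> :: real assume A: "A \<in> sets lebesgue" and \<gamma>: "0 < \<gamma>" "\<gamma> < 1"
  from lim[OF \<gamma> indicator_in_L0[OF A]]
  show "AE x in lebesgue. x \<notin> A \<longrightarrow> (\<forall>\<^sub>F B in basis_filter \<B> x. rel_density A B < \<gamma>)"
  proof eventually_elim
    case (elim x)
    show ?case
    proof
      assume "x \<notin> A"
      then have "(median \<gamma> (indicator A) \<longlongrightarrow> 0) (basis_filter \<B> x)"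
        using elim by (simp add: has_basis_limit_iff_tendsto[OF bf_differentiation_basis[OF bf]])
      then have "\<forall>\<^sub>F B in basis_filter \<B> x. median \<gamma> (indicator A) B < 1"
        by (rule order_tendstoD(2)) simp
      with eventually_in_basis show "\<forall>\<^sub>F B in basis_filter \<B> x. rel_density A B < \<gamma>"
      proof eventually_elim
        case (elim B)
        then have B: "B \<in> basis_sets \<B>"
          using basis_set_mem_iff[OF bf] by blast
        show ?case
        proof (rule ccontr)
          assume "\<not> ?case"
          then have *: "ennreal \<gamma> * emeasure lebesgue B \<le> emeasure lebesgue (A \<inter> B)"
            using rel_density_ge_iff[OF bf B A] \<gamma> by simp
          have "1 \<le> median \<gamma> (indicator A) B"
          proof (rule median_geI)
            fix a assume "ereal a < 1"
            then have "A \<inter> B \<subseteq> {y\<in>B. indicator A y > ereal a}"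
              by auto
            moreover have "{y\<in>B. indicator A y > ereal a} = {y. indicator A y > ereal a} \<inter> B"
              by auto
            then have "{y\<in>B. indicator A y > ereal a} \<in> sets lebesgue"
              using indicator_in_L0[OF A] basis_set(3)[OF bf B]
              by (auto simp: L0_def intro!: superlevel_in_sets_lebesgue)
            ultimately show "ennreal \<gamma> * emeasure lebesgue B
                \<le> emeasure lebesgue {y\<in>B. indicator A y > ereal a}"
              using * emeasure_mono order_trans by blast
          qed
          then show False
            using elim by simp
        qed
      qed
    qed
  qed
qed

end

section \<open>The halo of a set\<close>

text \<open>The superlevel set at the height \<open>\<gamma>\<close> of the maximal function of \<open>indicator A\<close> with respect to
\<open>\<B>\<close>, up to points where a supremum equal to \<open>\<gamma>\<close> is not attained.  The inequality is weak
because \<open>\<lambda> < median \<gamma> f B\<close> only forces \<open>{f > \<lambda>}\<close> to occupy at least the portion \<open>\<gamma>\<close> of \<open>B\<close>.\<close>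

definition halo :: "('a::euclidean_space \<Rightarrow> 'a set set) \<Rightarrow> real \<Rightarrow> 'a set \<Rightarrow> 'a set" where
  "halo \<B> \<gamma> A = \<Union>{B\<in>basis_sets \<B>. ennreal \<gamma> * emeasure lebesgue B \<le> emeasure lebesgue (A \<inter> B)}"

text \<open>The Tauberian condition: the maximal operator of \<open>\<B>\<close> satisfies, at the height \<open>\<gamma>\<close>, a weak type
inequality on indicator functions.\<close>

definition tauberian :: "('a::euclidean_space \<Rightarrow> 'a set set) \<Rightarrow> real \<Rightarrow> bool" where
  "tauberian \<B> \<gamma> \<longleftrightarrow>
     (\<exists>C::real. \<forall>A\<in>sets lebesgue. emeasure lebesgue (halo \<B> \<gamma> A) \<le> ennreal C * emeasure lebesgue A)"

lemma open_halo: "busemann_feller_basis \<B> \<Longrightarrow> open (halo \<B> \<gamma> A)"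
  unfolding halo_def using basis_set(1) by blast

lemma halo_null:
  assumes bf: "busemann_feller_basis \<B>" and "0 < \<gamma>" "emeasure lebesgue A = 0" "A \<in> sets lebesgue"
  shows "halo \<B> \<gamma> A = {}"
proof -
  have "\<not> ennreal \<gamma> * emeasure lebesgue B \<le> emeasure lebesgue (A \<inter> B)" if "B \<in> basis_sets \<B>" for B
  proof -
    have "emeasure lebesgue (A \<inter> B) \<le> emeasure lebesgue A"
      using assms by (intro emeasure_mono) auto
    then show ?thesis
      using assms basis_set(4)[OF bf that] by (simp add: basis_emeasure[OF bf that])
  qed
  then show ?thesis
    unfolding halo_def by auto
qed

text \<open>Fix \<open>A\<close> and enclose its complement in open sets \<open>T n\<close> that meet \<open>A\<close> only in small measure.  Near a
point outside \<open>A\<close> the sets \<open>B\<close> lie inside \<open>T n\<close>, so there \<open>A\<close> looks like the small set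
\<open>T n \<inter> A\<close>.  Hence the points outside \<open>A\<close> at which \<open>A\<close> keeps density \<open>\<gamma>\<close> lie in every
\<open>halo \<B> \<gamma> (T n \<inter> A)\<close>, and the measures of these halos tend to 0.\<close>

lemma tauberian_imp_density_basis:
  assumes bf: "busemann_feller_basis \<B>"
    and taub: "\<And>\<gamma>. 0 < \<gamma> \<Longrightarrow> \<gamma> < 1 \<Longrightarrow> tauberian \<B> \<gamma>"
  shows "density_basis \<B>"
proof (rule density_basisI[OF bf])
  fix A :: "'a set" and \<gamma> :: real
  assume A: "A \<in> sets lebesgue" and \<gamma>: "0 < \<gamma>" "\<gamma> < 1"
  obtain C :: real where C:
    "\<And>A. A \<in> sets lebesgue \<Longrightarrow> emeasure lebesgue (halo \<B> \<gamma> A) \<le> ennreal C * emeasure lebesgue A"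
    using taub[OF \<gamma>] unfolding tauberian_def by blast
  have cA: "- A \<in> sets lebesgue"
    using A by (metis Compl_in_sets_lebesgue)
  have "\<exists>T. open T \<and> - A \<subseteq> T \<and> T \<inter> A \<in> sets lebesgue \<and>
      emeasure lebesgue (T \<inter> A) \<le> ennreal (1 / real (Suc n))" for n
  proof -
    have "0 < 1 / real (Suc n)"
      by simp
    then obtain T where "open T" "- A \<subseteq> T" "T - - A \<in> lmeasurable"
        "emeasure lebesgue (T - - A) < ennreal (1 / real (Suc n))"
      by (rule sets_lebesgue_outer_open[OF cA])
    then show ?thesis
      unfolding Diff_Compl by (blast intro: fmeasurableD less_imp_le)
  qed
  then obtain T where T: "\<And>n. open (T n)" "\<And>n. - A \<subseteq> T n" "\<And>n. T n \<inter> A \<in> sets lebesgue"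
      "\<And>n. emeasure lebesgue (T n \<inter> A) \<le> ennreal (1 / real (Suc n))"
    by metis
  define N where "N = (\<Inter>n. halo \<B> \<gamma> (T n \<inter> A))"
  have halo_meas: "halo \<B> \<gamma> E \<in> sets lebesgue" for E
    by (intro open_in_sets_lebesgue open_halo bf)
  have "N \<in> null_sets lebesgue"
  proof (rule null_setsI)
    show "N \<in> sets lebesgue"
      unfolding N_def using halo_meas by blast
    have "emeasure lebesgue N \<le> ennreal C * ennreal (1 / real (Suc n))" for n
    proof -
      have "emeasure lebesgue N \<le> emeasure lebesgue (halo \<B> \<gamma> (T n \<inter> A))"
        unfolding N_def by (intro emeasure_mono halo_meas) auto
      also have "\<dots> \<le> ennreal C * emeasure lebesgue (T n \<inter> A)"
        by (rule C[OF T(3)])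
      also have "\<dots> \<le> ennreal C * ennreal (1 / real (Suc n))"
        by (intro mult_left_mono T) simp
      finally show ?thesis .
    qed
    moreover have "(\<lambda>n. ennreal C * ennreal (1 / real (Suc n))) \<longlonglongrightarrow> ennreal C * 0"
      using LIMSEQ_inverse_real_of_nat
      by (intro ennreal_tendsto_cmult) (simp_all add: ennreal_tendsto_0_iff inverse_eq_divide)
    ultimately show "emeasure lebesgue N = 0"
      using LIMSEQ_le_const[of _ "ennreal C * 0" "emeasure lebesgue N"] by simp
  qed
  moreover have "\<forall>\<^sub>F B in basis_filter \<B> x. rel_density A B < \<gamma>" if "x \<notin> A" "x \<notin> N" for x
  proof -
    obtain n where n: "x \<notin> halo \<B> \<gamma> (T n \<inter> A)"
      using \<open>x \<notin> N\<close> by (auto simp: N_def)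
    obtain \<epsilon> where \<epsilon>: "\<epsilon> > 0" "ball x \<epsilon> \<subseteq> T n"
      using T(1,2) \<open>x \<notin> A\<close> by (meson ComplI open_contains_ball subsetD)
    have "rel_density A B < \<gamma>" if B: "B \<in> \<B> x" "diameter B < \<epsilon>" for B
    proof -
      have B': "B \<in> basis_sets \<B>" "x \<in> B"
        using B basis_set_mem_iff[OF bf] by auto
      have "B \<subseteq> T n"
        using \<epsilon>(2) diameter_bounded_bound[OF basis_set(2)[OF bf B'(1)] B'(2)] B(2)
        by (force simp: subset_eq)
      then have "A \<inter> B = (T n \<inter> A) \<inter> B"
        by auto
      then show ?thesis
        using n B' rel_density_ge_iff[OF bf B'(1) A, of \<gamma>] \<gamma> by (auto simp: halo_def not_le[symmetric])
    qed
    then show ?thesis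
      unfolding eventually_basis_filter using \<epsilon>(1) by blast
  qed
  ultimately show "AE x in lebesgue. x \<notin> A \<longrightarrow> (\<forall>\<^sub>F B in basis_filter \<B> x. rel_density A B < \<gamma>)"
    by (intro AE_I'[of N]) auto
qed

section \<open>Homothetic copies\<close>

abbreviation homothety :: "'a::real_vector \<Rightarrow> real \<Rightarrow> 'a \<Rightarrow> 'a" where
  "homothety a t \<equiv> \<lambda>y. a + t *\<^sub>R y"

lemma inj_homothety: "0 < t \<Longrightarrow> inj (homothety a t)"
  by (auto simp: inj_on_def)

lemma emeasure_homothety:
  fixes S :: "'a::euclidean_space set"
  assumes "0 < t"
  shows "emeasure lebesgue (homothety a t ` S) = ennreal (t ^ DIM('a)) * emeasure lebesgue S"
  using emeasure_lebesgue_affine[of t a S] assms by (simp add: add.commute)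

lemma homothety_in_sets_lebesgue:
  fixes S :: "'a::euclidean_space set"
  assumes "S \<in> sets lebesgue" "0 < t"
  shows "homothety a t ` S \<in> sets lebesgue"
proof -
  have "(*\<^sub>R) t ` S = (*\<^sub>R) (1 / t) -` S \<inter> space lebesgue"
    using assms(2) by (force simp: image_iff)
  then have "(*\<^sub>R) t ` S \<in> sets lebesgue"
    using measurable_sets[OF lebesgue_measurable_scaling assms(1)] by metis
  from lebesgue_sets_translation[OF this, of a] show ?thesis
    by (simp add: image_image)
qed

lemma homothety_dense_basis_set:
  fixes B :: "'a::euclidean_space set"
  assumes "homothecy_invariant \<B>" "0 < t" "B \<in> basis_sets \<B>"
    and "ennreal \<gamma> * emeasure lebesgue B \<le> emeasure lebesgue (A \<inter> B)"
  shows "homothety a t ` B \<in> basis_sets \<B>"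
    and "ennreal \<gamma> * emeasure lebesgue (homothety a t ` B)
      \<le> emeasure lebesgue (homothety a t ` A \<inter> homothety a t ` B)"
proof -
  show "homothety a t ` B \<in> basis_sets \<B>"
    using assms by (simp add: homothecy_invariant_def)
  have "ennreal (t ^ DIM('a)) * (ennreal \<gamma> * emeasure lebesgue B)
      \<le> ennreal (t ^ DIM('a)) * emeasure lebesgue (A \<inter> B)"
    using assms by (intro mult_left_mono) auto
  then show "ennreal \<gamma> * emeasure lebesgue (homothety a t ` B)
      \<le> emeasure lebesgue (homothety a t ` A \<inter> homothety a t ` B)"
    using assms(2) by (simp add: emeasure_homothety image_Int[OF inj_homothety, symmetric] ac_simps)
qed

lemma homothety_halo_subset:
  fixes A :: "'a::euclidean_space set"
  assumes "homothecy_invariant \<B>" "0 < t"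
  shows "homothety a t ` halo \<B> \<gamma> A \<subseteq> halo \<B> \<gamma> (homothety a t ` A)"
proof
  fix x assume "x \<in> homothety a t ` halo \<B> \<gamma> A"
  then obtain B where "B \<in> basis_sets \<B>" "x \<in> homothety a t ` B"
      "ennreal \<gamma> * emeasure lebesgue B \<le> emeasure lebesgue (A \<inter> B)"
    unfolding halo_def by auto
  then show "x \<in> halo \<B> \<gamma> (homothety a t ` A)"
    unfolding halo_def using homothety_dense_basis_set[OF assms] by blast
qed

section \<open>Covering half of a ball by few translates\<close>

text \<open>Fubini: \<open>x\<close> lies in \<open>U \<inter> (a + K)\<close> iff \<open>x \<in> U\<close> and \<open>x - a \<in> K\<close>, and for fixed \<open>x\<close> the set of such
\<open>a\<close> is a reflected translate of \<open>K\<close>.\<close>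

lemma nn_integral_emeasure_Int_translate:
  fixes K U :: "'a::euclidean_space set"
  assumes [measurable]: "K \<in> sets borel" "U \<in> sets borel"
  shows "(\<integral>\<^sup>+a. emeasure lborel (U \<inter> (+) a ` K) \<partial>lborel) = emeasure lborel U * emeasure lborel K"
proof -
  have tr: "(\<integral>\<^sup>+a. f (c - a) \<partial>lborel) = (\<integral>\<^sup>+a. f a \<partial>lborel)"
    if [measurable]: "f \<in> borel_measurable borel" for f :: "'a \<Rightarrow> ennreal" and c
  proof -
    have "(\<integral>\<^sup>+a. f a \<partial>lborel) = (\<integral>\<^sup>+a. f a \<partial>density (distr lborel borel (\<lambda>x. c + (-1) *\<^sub>R x)) (\<lambda>_. ennreal (\<bar>-1\<bar> ^ DIM('a))))"
      by (subst lborel_affine[of "-1" c]) auto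
    also have "\<dots> = (\<integral>\<^sup>+a. f (c - a) \<partial>lborel)"
      by (simp add: density_1 nn_integral_distr)
    finally show ?thesis ..
  qed
  have im: "(+) a ` K = {x. x - a \<in> K}" for a
    by force
  have "(\<integral>\<^sup>+a. emeasure lborel (U \<inter> (+) a ` K) \<partial>lborel)
      = (\<integral>\<^sup>+a. \<integral>\<^sup>+x. indicator U x * indicator K (x - a) \<partial>lborel \<partial>lborel)"
  proof (rule nn_integral_cong)
    fix a :: 'a
    have "emeasure lborel (U \<inter> (+) a ` K) = (\<integral>\<^sup>+x. indicator (U \<inter> {x. x - a \<in> K}) x \<partial>lborel)"
      unfolding im by (rule nn_integral_indicator[symmetric]) measurable
    moreover have "indicator (U \<inter> {x. x - a \<in> K}) x = (indicator U x * indicator K (x - a) :: ennreal)" for x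
      by (simp split: split_indicator)
    ultimately show "emeasure lborel (U \<inter> (+) a ` K)
        = (\<integral>\<^sup>+x. indicator U x * indicator K (x - a) \<partial>lborel)"
      by simp
  qed
  also have "\<dots> = (\<integral>\<^sup>+x. \<integral>\<^sup>+a. indicator U x * indicator K (x - a) \<partial>lborel \<partial>lborel)"
    by (rule lborel_pair.Fubini') measurable
  also have "\<dots> = (\<integral>\<^sup>+x. indicator U x * emeasure lborel K \<partial>lborel)"
    by (simp add: nn_integral_cmult tr[of "indicator K"])
  also have "\<dots> = emeasure lborel U * emeasure lborel K"
    by (simp add: nn_integral_multc)
  finally show ?thesis .
qed

text \<open>Averaging over \<open>a\<close>: only \<open>a\<close> in the ball of radius 2 contribute to the integral
\<open>nn_integral_emeasure_Int_translate\<close>, so some translate covers at least the average portion of \<open>U\<close>.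
The factor 2 in the denominator leaves room for a strict inequality, so that no maximising
translate has to be found.\<close>

lemma exists_translate_Int_large:
  fixes K U :: "'a::euclidean_space set"
  assumes [measurable]: "K \<in> sets borel" "U \<in> sets borel"
    and sub: "K \<subseteq> ball 0 1" "U \<subseteq> ball 0 1"
  shows "\<exists>a. measure lborel U * measure lborel K / (2 * measure lborel (ball 0 2 :: 'a set))
      \<le> measure lborel (U \<inter> (+) a ` K)"
proof (rule ccontr)
  define V where "V = measure lborel (ball 0 2 :: 'a set)"
  define c where "c = measure lborel U * measure lborel K / (2 * V)"
  have ball_fin: "ball (0::'a) r \<in> fmeasurable lborel" for r
    using emeasure_lborel_ball_finite by (auto simp: fmeasurable_def)
  have V: "0 < V"
    unfolding V_def by (intro content_ball_pos) simp
  assume "\<not> ?thesis"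
  then have less: "measure lborel (U \<inter> (+) a ` K) < c" for a
    unfolding c_def V_def by (meson not_le)
  then have "0 < c"
    by (meson le_less_trans measure_nonneg)
  then have pos: "0 < measure lborel U * measure lborel K"
    using V by (simp add: c_def zero_less_divide_iff)
  have U: "U \<in> fmeasurable lborel" and K: "K \<in> fmeasurable lborel"
    using sub by (auto intro: fmeasurableI2[OF ball_fin])
  have UK: "U \<inter> (+) a ` K \<in> fmeasurable lborel" for a
  proof -
    have "(+) a ` K = {x. x - a \<in> K}"
      by force
    then show ?thesis
      by (intro fmeasurableI2[OF U]) auto
  qed
  have "ennreal (measure lborel U * measure lborel K) = emeasure lborel U * emeasure lborel K"
    using U K by (simp add: emeasure_eq_measure2 ennreal_mult)
  also have "\<dots> = (\<integral>\<^sup>+a. emeasure lborel (U \<inter> (+) a ` K) \<partial>lborel)"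
    by (rule nn_integral_emeasure_Int_translate[symmetric]) measurable
  also have "\<dots> \<le> (\<integral>\<^sup>+a. ennreal c * indicator (ball 0 2) (a :: 'a) \<partial>lborel)"
  proof (rule nn_integral_mono)
    fix a :: 'a
    show "emeasure lborel (U \<inter> (+) a ` K) \<le> ennreal c * indicator (ball 0 2) a"
    proof (cases "a \<in> ball 0 2")
      case True
      then show ?thesis
        using less[of a] UK[of a] by (simp add: emeasure_eq_measure2 ennreal_leI)
    next
      case False
      have "U \<inter> (+) a ` K = {}"
      proof (rule ccontr)
        assume "U \<inter> (+) a ` K \<noteq> {}"
        then obtain k where "k \<in> K" "a + k \<in> U"
          by auto
        then have "norm k < 1" "norm (a + k) < 1"
          using sub by auto
        then have "norm a < 2"
          using norm_triangle_ineq4[of "a + k" k] by simp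
        with False show False
          by simp
      qed
      then show ?thesis
        by simp
    qed
  qed
  also have "\<dots> = ennreal (c * V)"
    using ball_fin[of 2] \<open>0 < c\<close> by (simp add: nn_integral_cmult emeasure_eq_measure2 ennreal_mult V_def)
  finally have "measure lborel U * measure lborel K \<le> c * V"
    using \<open>0 < c\<close> V by (simp add: ennreal_le_iff)
  then show False
    using pos V by (simp add: c_def mult.commute)
qed

text \<open>Choose translates greedily.  Each one removes at least the portion \<open>\<kappa>\<close> of what is still uncovered,
so after about \<open>1 / \<kappa>\<close> steps at most \<open>exp (- 1)\<close> of the unit ball is left.  The point is the bound
on the total measure of the translates by an absolute constant, however small \<open>K\<close> is and whatever
its shape.\<close>

lemma translates_cover_half_ball:
  fixes K :: "'a::euclidean_space set"
  assumes [measurable]: "K \<in> sets borel" and sub: "K \<subseteq> ball 0 1" and pos: "0 < measure lborel K"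
  obtains F :: "'a set" where "finite F"
    "real (card F) * measure lborel K \<le> 4 * measure lborel (ball 0 2 :: 'a set)"
    "measure lborel (ball 0 1 - (\<Union>a\<in>F. (+) a ` K)) \<le> measure lborel (ball 0 1 :: 'a set) / 2"
proof -
  define V where "V = measure lborel (ball 0 2 :: 'a set)"
  \<comment> \<open>The portion of the uncovered set that one well chosen translate removes.\<close>
  define \<kappa> where "\<kappa> = measure lborel K / (2 * V)"
  let ?Q = "ball 0 1 :: 'a set"
  have ball_fin: "ball (0::'a) r \<in> fmeasurable lborel" for r
    using emeasure_lborel_ball_finite by (auto simp: fmeasurable_def)
  have V: "0 < V"
    unfolding V_def by (intro content_ball_pos) simp
  have "measure lborel K \<le> V"
    unfolding V_def using sub by (intro measure_mono_fmeasurable ball_fin) auto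
  then have \<kappa>: "0 < \<kappa>" "\<kappa> \<le> 1"
    using pos V by (auto simp: \<kappa>_def)
  have tr [measurable]: "(+) a ` K \<in> sets borel" for a
  proof -
    have "(+) a ` K = {x. x - a \<in> K}"
      by force
    then show ?thesis
      by auto
  qed
  have greedy: "\<exists>F::'a set. finite F \<and> card F \<le> N \<and>
      measure lborel (?Q - (\<Union>a\<in>F. (+) a ` K)) \<le> (1 - \<kappa>) ^ N * measure lborel ?Q" for N
  proof (induction N)
    case 0
    show ?case
      by (intro exI[of _ "{}"]) simp
  next
    case (Suc N)
    then obtain F :: "'a set" where F: "finite F" "card F \<le> N"
        "measure lborel (?Q - (\<Union>a\<in>F. (+) a ` K)) \<le> (1 - \<kappa>) ^ N * measure lborel ?Q"
      by blast
    define U where "U = ?Q - (\<Union>a\<in>F. (+) a ` K)"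
    have [measurable]: "U \<in> sets borel"
      unfolding U_def using F(1) tr by (intro sets.Diff sets.finite_UN) auto
    then have "U \<in> fmeasurable lborel"
      by (intro fmeasurableI2[OF ball_fin[of 1]]) (auto simp: U_def)
    have "U \<subseteq> ball 0 1"
      by (auto simp: U_def)
    then obtain a where a: "\<kappa> * measure lborel U \<le> measure lborel (U \<inter> (+) a ` K)"
      using exists_translate_Int_large[of K U] sub by (auto simp: \<kappa>_def V_def mult.commute)
    have "?Q - (\<Union>b\<in>insert a F. (+) b ` K) = U - U \<inter> (+) a ` K"
      by (auto simp: U_def)
    also have "measure lborel \<dots> = measure lborel U - measure lborel (U \<inter> (+) a ` K)"
      using \<open>U \<in> fmeasurable lborel\<close> by (intro measurable_measure_Diff) auto
    also have "\<dots> \<le> (1 - \<kappa>) * measure lborel U"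
      using a by (simp add: algebra_simps)
    also have "\<dots> \<le> (1 - \<kappa>) * ((1 - \<kappa>) ^ N * measure lborel ?Q)"
      using \<kappa> F(3) by (intro mult_left_mono) (auto simp: U_def)
    finally show ?case
      using F card_insert_le_m1[of "Suc N" F a]
      by (intro exI[of _ "insert a F"]) (simp add: card_insert_if)
  qed
  define N where "N = nat \<lceil>1 / \<kappa>\<rceil>"
  have N: "1 / \<kappa> \<le> real N" "real N \<le> 2 / \<kappa>"
  proof -
    have "1 \<le> 1 / \<kappa>"
      using \<kappa> by simp
    moreover have "real N \<le> 1 / \<kappa> + 1"
      using \<kappa> by (simp add: N_def)
    moreover have "2 / \<kappa> = 1 / \<kappa> + 1 / \<kappa>"
      by simp
    ultimately show "1 / \<kappa> \<le> real N" "real N \<le> 2 / \<kappa>"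
      unfolding N_def by linarith+
  qed
  have "(1 - \<kappa>) ^ N \<le> exp (- \<kappa>) ^ N"
    using \<kappa> exp_ge_add_one_self[of "- \<kappa>"] by (intro power_mono) auto
  also have "\<dots> = exp (- (real N * \<kappa>))"
    by (simp add: exp_of_nat_mult[symmetric])
  also have "\<dots> \<le> exp (- 1)"
    using N(1) \<kappa> by (simp add: field_simps)
  also have "\<dots> \<le> 1 / 2"
    using exp_ge_add_one_self[of 1] by (simp add: exp_minus field_simps)
  finally have half: "(1 - \<kappa>) ^ N \<le> 1 / 2" .
  obtain F :: "'a set" where F: "finite F" "card F \<le> N"
      "measure lborel (?Q - (\<Union>a\<in>F. (+) a ` K)) \<le> (1 - \<kappa>) ^ N * measure lborel ?Q"
    using greedy by blast
  show thesis
  proof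
    have "real (card F) * measure lborel K \<le> 2 / \<kappa> * measure lborel K"
      using F(2) N(2) by (intro mult_right_mono) auto
    also have "\<dots> = 4 * V"
      using pos V by (simp add: \<kappa>_def field_simps)
    finally show "real (card F) * measure lborel K \<le> 4 * measure lborel (ball 0 2 :: 'a set)"
      by (simp add: V_def)
    have "(1 - \<kappa>) ^ N * measure lborel ?Q \<le> 1 / 2 * measure lborel ?Q"
      using half by (intro mult_right_mono) auto
    with F(3) show "measure lborel (?Q - (\<Union>a\<in>F. (+) a ` K)) \<le> measure lborel ?Q / 2"
      by linarith
  qed (use F in simp)
qed

section \<open>What happens when the halo estimate fails\<close>

text \<open>If the Tauberian condition fails at height \<open>\<gamma>\<close>, some \<open>A\<close> is tiny compared with its halo.  Cut the
halo down to the sets inside a large ball, shrink the picture so that everything becomes smaller than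
\<open>\<delta>\<close>, and spread translated copies so that the shrunken halos cover half of the unit ball.  The
measures of these halos add up to at most an absolute constant, so those of the copies of \<open>A\<close> add
up to little.  Homothecy invariance
guarantees that the copies of the sets of \<open>\<B>\<close> again belong to \<open>\<B>\<close>.\<close>

lemma not_tauberian_bad_set:
  fixes \<B> :: "'a::euclidean_space \<Rightarrow> 'a set set"
  assumes bf: "busemann_feller_basis \<B>" and hi: "homothecy_invariant \<B>"
    and not_taub: "\<not> tauberian \<B> \<gamma>" and "0 < \<epsilon>" "0 < \<delta>"
  obtains E G where "E \<in> sets lebesgue" "emeasure lebesgue E \<le> ennreal \<epsilon>" "open G"
    "emeasure lebesgue (ball 0 1 - G) \<le> ennreal (measure lebesgue (ball 0 1 :: 'a set) / 2)"
    "\<And>x. x \<in> G \<Longrightarrow> \<exists>B\<in>\<B> x. diameter B < \<delta> \<and>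
        ennreal \<gamma> * emeasure lebesgue B \<le> emeasure lebesgue (E \<inter> B)"
proof -
  define V where "V = measure lborel (ball 0 2 :: 'a set)"
  have V: "0 < V"
    unfolding V_def by (intro content_ball_pos) simp
  \<comment> \<open>The shrunken halos have total measure at most \<open>4 * V\<close>; the ratio \<open>C\<close> brings the copies of \<open>A\<close>
    down to \<open>\<epsilon>\<close>.\<close>
  define C where "C = 4 * V / \<epsilon>"
  have C: "0 < C"
    using V \<open>0 < \<epsilon>\<close> by (simp add: C_def)
  obtain A where A: "A \<in> sets lebesgue" "ennreal C * emeasure lebesgue A < emeasure lebesgue (halo \<B> \<gamma> A)"
    using not_taub unfolding tauberian_def by (meson not_le)
  then have "ennreal C * emeasure lebesgue A \<noteq> \<infinity>"
    by auto
  then have "emeasure lebesgue A \<noteq> \<infinity>"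
    using C by (auto simp: ennreal_mult_eq_top_iff)
  then obtain \<alpha> where \<alpha>: "0 \<le> \<alpha>" "emeasure lebesgue A = ennreal \<alpha>"
    by (cases "emeasure lebesgue A") auto
  define dense where "dense = {B\<in>basis_sets \<B>. ennreal \<gamma> * emeasure lebesgue B \<le> emeasure lebesgue (A \<inter> B)}"
  define D where "D = (\<lambda>R::nat. \<Union>{B\<in>dense. B \<subseteq> ball 0 (real R)})"
  have dense: "open B" "bounded B" if "B \<in> dense" for B
    using that basis_set[OF bf] by (auto simp: dense_def)
  have open_D: "open (D R)" for R
    using dense by (auto simp: D_def)
  have "(\<Union>R. D R) = halo \<B> \<gamma> A"
  proof
    show "halo \<B> \<gamma> A \<subseteq> (\<Union>R. D R)"
    proof
      fix x assume "x \<in> halo \<B> \<gamma> A"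
      then obtain B where B: "B \<in> dense" "x \<in> B"
        by (auto simp: halo_def dense_def)
      then obtain r where r: "B \<subseteq> ball 0 r"
        using dense(2) bounded_subset_ballD by blast
      obtain R :: nat where "r \<le> real R"
        using real_arch_simple by blast
      then have "B \<subseteq> ball 0 (real R)"
        using r by (meson order_trans subset_ball)
      then show "x \<in> (\<Union>R. D R)"
        using B by (auto simp: D_def)
    qed
  qed (auto simp: D_def dense_def halo_def)
  moreover have "incseq D"
  proof (rule monoI)
    fix m n :: nat assume "m \<le> n"
    then have "ball (0::'a) (real m) \<subseteq> ball 0 (real n)"
      by (intro subset_ball) simp
    then show "D m \<subseteq> D n"
      unfolding D_def by blast
  qed
  then have "(SUP R. emeasure lebesgue (D R)) = emeasure lebesgue (\<Union>R. D R)"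
    by (intro SUP_emeasure_incseq) (auto intro: open_in_sets_lebesgue open_D)
  ultimately have "ennreal C * emeasure lebesgue A < (SUP R. emeasure lebesgue (D R))"
    using A(2) by (simp only:)
  then obtain R where R: "ennreal C * emeasure lebesgue A < emeasure lebesgue (D R)"
    unfolding less_SUP_iff by blast
  \<comment> \<open>The scale brings \<open>D R\<close> into the unit ball and the diameters of its sets below \<open>\<delta>\<close>.\<close>
  define t where "t = min 1 (\<delta> / 3) / (real R + 1)"
  have t: "0 < t" "t * real R \<le> 1" "2 * (t * real R) < \<delta>"
  proof -
    show "0 < t"
      using \<open>0 < \<delta>\<close> by (simp add: t_def)
    have "t * (real R + 1) = min 1 (\<delta> / 3)"
      by (simp add: t_def)
    then have "t + t * real R = min 1 (\<delta> / 3)"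
      by (simp add: distrib_left)
    then have "t + t * real R \<le> 1" "t + t * real R \<le> \<delta> / 3"
      by simp_all
    with \<open>0 < t\<close> \<open>0 < \<delta>\<close> show "t * real R \<le> 1" "2 * (t * real R) < \<delta>"
      by linarith+
  qed
  define K where "K = homothety 0 t ` D R"
  have "open K"
    unfolding K_def by (rule open_affinity) (use open_D t in auto)
  have K_sub: "K \<subseteq> ball 0 1"
  proof
    fix x assume "x \<in> K"
    then obtain y where y: "x = t *\<^sub>R y" "y \<in> D R"
      by (auto simp: K_def)
    then have "norm y < real R"
      unfolding D_def by auto
    then have "norm x < t * real R"
      using t y by simp
    then show "x \<in> ball 0 1"
      using t by simp
  qed
  have ball_fin: "ball (0::'a) 1 \<in> fmeasurable lborel"
    using emeasure_lborel_ball_finite by (auto simp: fmeasurable_def)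
  then have "K \<in> fmeasurable lborel"
    by (rule fmeasurableI2) (use K_sub \<open>open K\<close> in auto)
  define k where "k = measure lborel K"
  have k: "C * (t ^ DIM('a) * \<alpha>) < k"
  proof -
    have "ennreal (C * (t ^ DIM('a) * \<alpha>)) = ennreal (t ^ DIM('a)) * (ennreal C * emeasure lebesgue A)"
      using C t \<alpha> by (simp add: ennreal_mult mult.left_commute)
    also have "\<dots> < ennreal (t ^ DIM('a)) * emeasure lebesgue (D R)"
      using R t by (intro ennreal_mult_strict_left_mono) auto
    also have "\<dots> = emeasure lebesgue K"
      by (simp only: K_def emeasure_homothety[OF t(1)])
    also have "\<dots> = ennreal k"
      using \<open>K \<in> fmeasurable lborel\<close> \<open>open K\<close> by (simp add: k_def emeasure_eq_measure2)
    finally show ?thesis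
      using C t \<alpha> by (subst (asm) ennreal_less_iff) auto
  qed
  then have "0 < k"
    using C t \<alpha> by (meson le_less_trans mult_nonneg_nonneg less_imp_le zero_le_power)
  have "K \<in> sets borel"
    using \<open>open K\<close> by simp
  then obtain F :: "'a set" where F: "finite F" "real (card F) * k \<le> 4 * V"
      "measure lborel (ball 0 1 - (\<Union>a\<in>F. (+) a ` K)) \<le> measure lborel (ball 0 1 :: 'a set) / 2"
    by (rule translates_cover_half_ball[OF _ K_sub, folded k_def V_def]) (rule \<open>0 < k\<close>)
  define E where "E = (\<Union>a\<in>F. homothety a t ` A)"
  define G where "G = (\<Union>a\<in>F. (+) a ` K)"
  show thesis
  proof
    show E: "E \<in> sets lebesgue"
      unfolding E_def using F(1) A(1) t by (intro sets.finite_UN homothety_in_sets_lebesgue) auto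
    have "emeasure lebesgue E \<le> (\<Sum>a\<in>F. emeasure lebesgue (homothety a t ` A))"
      unfolding E_def using F(1) A(1) t
      by (intro emeasure_subadditive_finite) (auto intro!: homothety_in_sets_lebesgue)
    also have "\<dots> = (\<Sum>a\<in>F. ennreal (t ^ DIM('a) * \<alpha>))"
      using t \<alpha> by (simp only: emeasure_homothety[OF t(1)] \<alpha>(2)) (simp add: ennreal_mult)
    also have "\<dots> = ennreal (real (card F) * (t ^ DIM('a) * \<alpha>))"
      using t \<alpha> by (subst sum_ennreal) auto
    also have "\<dots> \<le> ennreal \<epsilon>"
    proof (rule ennreal_leI)
      let ?b = "t ^ DIM('a) * \<alpha>"
      have b: "0 \<le> ?b"
        using t \<alpha> by simp
      have "(real (card F) * ?b) * k = (real (card F) * k) * ?b"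
        by (simp only: ac_simps)
      also have "\<dots> \<le> 4 * V * ?b"
        using F(2) b by (rule mult_right_mono)
      also have "\<dots> = \<epsilon> * (C * ?b)"
        using \<open>0 < \<epsilon>\<close> by (simp add: C_def)
      also have "\<dots> \<le> \<epsilon> * k"
        using k \<open>0 < \<epsilon>\<close> by (intro mult_left_mono) auto
      finally show "real (card F) * ?b \<le> \<epsilon>"
        using \<open>0 < k\<close> by simp
    qed
    finally show "emeasure lebesgue E \<le> ennreal \<epsilon>" .
    show "open G"
      unfolding G_def using \<open>open K\<close> by (auto intro: open_translation)
    then have "ball 0 1 - G \<in> sets borel"
      by auto
    moreover from this have "ball 0 1 - G \<in> fmeasurable lborel"
      by (intro fmeasurableI2[OF ball_fin]) auto
    ultimately show "emeasure lebesgue (ball 0 1 - G) \<le> ennreal (measure lebesgue (ball 0 1 :: 'a set) / 2)"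
      using F(3) by (simp add: emeasure_eq_measure2 ennreal_leI G_def)
    fix x assume "x \<in> G"
    then obtain a d where a: "a \<in> F" "d \<in> D R" "x = a + t *\<^sub>R d"
      by (auto simp: G_def K_def)
    then obtain B where B: "B \<in> dense" "B \<subseteq> ball 0 (real R)" "d \<in> B"
      by (auto simp: D_def)
    let ?B = "homothety a t ` B"
    have "B \<in> basis_sets \<B>" "ennreal \<gamma> * emeasure lebesgue B \<le> emeasure lebesgue (A \<inter> B)"
      using B(1) unfolding dense_def by blast+
    note B_dense = homothety_dense_basis_set[OF hi t(1) this, of a]
    have B': "?B \<in> basis_sets \<B>" "ennreal \<gamma> * emeasure lebesgue ?B
        \<le> emeasure lebesgue (homothety a t ` A \<inter> ?B)"
      by (fact B_dense)+
    have "?B \<in> \<B> x"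
      using B' a B basis_set_mem_iff[OF bf] by auto
    moreover have "diameter ?B \<le> 2 * (t * real R)"
    proof (rule diameter_le)
      fix u v assume "u \<in> ?B" "v \<in> ?B"
      then obtain u' v' where uv: "u = a + t *\<^sub>R u'" "v = a + t *\<^sub>R v'" "norm u' < real R" "norm v' < real R"
        using B(2) by (auto simp: subset_eq)
      then have "norm (u - v) = t * norm (u' - v')"
        using t by (simp add: scaleR_diff_right[symmetric])
      also have "\<dots> \<le> t * (real R + real R)"
        using uv t norm_triangle_ineq4[of u' v'] by (intro mult_left_mono) auto
      finally show "norm (u - v) \<le> 2 * (t * real R)"
        by (simp add: algebra_simps)
    qed (use B in auto)
    then have "diameter ?B < \<delta>"
      using t(3) by simp
    moreover have "emeasure lebesgue (homothety a t ` A \<inter> ?B) \<le> emeasure lebesgue (E \<inter> ?B)"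
      using E a(1) basis_set(3)[OF bf B'(1)] by (intro emeasure_mono) (auto simp: E_def fmeasurableD)
    ultimately show "\<exists>B\<in>\<B> x. diameter B < \<delta> \<and>
        ennreal \<gamma> * emeasure lebesgue B \<le> emeasure lebesgue (E \<inter> B)"
      using B'(2) by (blast intro: order_trans)
  qed
qed

text \<open>Take bad sets for the scales \<open>1 / (k + 1)\<close> and measure bounds \<open>\<epsilon> k\<close>, and let \<open>H\<close> be the upper limit
of the regions on which they are bad.  Since each region misses at most half of the unit ball, so does
\<open>H\<close>, and \<open>H\<close> cannot be hidden in a set of a quarter of the measure of the ball.\<close>

lemma not_tauberian_bad_sequence:
  fixes \<B> :: "'a::euclidean_space \<Rightarrow> 'a set set" and \<epsilon> :: "nat \<Rightarrow> real"
  assumes bf: "busemann_feller_basis \<B>" and hi: "homothecy_invariant \<B>"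
    and not_taub: "\<not> tauberian \<B> \<gamma>" and \<epsilon>: "\<And>k. 0 < \<epsilon> k"
  obtains E H where "\<forall>k. E k \<in> sets lebesgue" "\<forall>k. emeasure lebesgue (E k) \<le> ennreal (\<epsilon> k)"
    "\<forall>x\<in>H. \<forall>m. \<exists>k\<ge>m. \<exists>B\<in>\<B> x. diameter B < 1 / real (Suc k) \<and>
        ennreal \<gamma> * emeasure lebesgue B \<le> emeasure lebesgue (E k \<inter> B)"
    "\<forall>S\<in>sets lebesgue.
        emeasure lebesgue S \<le> ennreal (measure lebesgue (ball 0 1 :: 'a set) / 4) \<longrightarrow>
        \<not> (AE x in lebesgue. x \<in> H \<longrightarrow> x \<in> S)"
proof -
  let ?Q = "ball 0 1 :: 'a set"
  have "\<exists>E G. E \<in> sets lebesgue \<and> emeasure lebesgue E \<le> ennreal (\<epsilon> k) \<and> open G \<and>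
      emeasure lebesgue (?Q - G) \<le> ennreal (measure lebesgue ?Q / 2) \<and>
      (\<forall>x\<in>G. \<exists>B\<in>\<B> x. diameter B < 1 / real (Suc k) \<and>
        ennreal \<gamma> * emeasure lebesgue B \<le> emeasure lebesgue (E \<inter> B))" for k
    by (rule not_tauberian_bad_set[OF bf hi not_taub \<epsilon>[of k], of "1 / real (Suc k)"]) (simp, blast)
  then obtain E G where EG: "\<And>k. E k \<in> sets lebesgue" "\<And>k. emeasure lebesgue (E k) \<le> ennreal (\<epsilon> k)"
      "\<And>k. open (G k)" "\<And>k. emeasure lebesgue (?Q - G k) \<le> ennreal (measure lebesgue ?Q / 2)"
      "\<And>k x. x \<in> G k \<Longrightarrow> \<exists>B\<in>\<B> x. diameter B < 1 / real (Suc k) \<and>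
        ennreal \<gamma> * emeasure lebesgue B \<le> emeasure lebesgue (E k \<inter> B)"
    by metis
  define H where "H = (\<Inter>m. \<Union>k\<in>{m..}. G k)"
  have meas: "?Q - (\<Union>k\<in>{m..}. G k) \<in> sets lebesgue" for m
    using EG(3) by (intro sets.Diff open_in_sets_lebesgue) auto
  have H: "H \<in> sets lebesgue"
    unfolding H_def by (intro sets.countable_INT') (auto intro!: open_in_sets_lebesgue EG(3))
  have "?Q - H = (\<Union>m. ?Q - (\<Union>k\<in>{m..}. G k))"
    by (auto simp: H_def)
  moreover have "emeasure lebesgue (\<Union>m. ?Q - (\<Union>k\<in>{m..}. G k))
      = (SUP m. emeasure lebesgue (?Q - (\<Union>k\<in>{m..}. G k)))"
    by (intro SUP_emeasure_incseq[symmetric]) (use meas in \<open>auto simp: incseq_def\<close>)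
  moreover have "emeasure lebesgue (?Q - (\<Union>k\<in>{m..}. G k)) \<le> ennreal (measure lebesgue ?Q / 2)" for m
    using EG(3) by (intro order_trans[OF emeasure_mono EG(4)[of m]]) (auto intro!: open_in_sets_lebesgue)
  ultimately have half: "emeasure lebesgue (?Q - H) \<le> ennreal (measure lebesgue ?Q / 2)"
    by (simp only: SUP_least)
  have big: "\<not> (AE x in lebesgue. x \<in> H \<longrightarrow> x \<in> S)" if S: "S \<in> sets lebesgue"
      "emeasure lebesgue S \<le> ennreal (measure lebesgue ?Q / 4)" for S
  proof
    assume "AE x in lebesgue. x \<in> H \<longrightarrow> x \<in> S"
    then obtain N where N: "{x. \<not> (x \<in> H \<longrightarrow> x \<in> S)} \<subseteq> N" "N \<in> null_sets lebesgue"
      by (auto simp: eventually_ae_filter)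
    have Q: "?Q - H \<in> sets lebesgue"
      by (rule sets.Diff[OF open_in_sets_lebesgue[OF open_ball] H])
    have "emeasure lebesgue ?Q \<le> emeasure lebesgue ((?Q - H) \<union> S \<union> N)"
      using N S Q by (intro emeasure_mono) auto
    also have "\<dots> = emeasure lebesgue ((?Q - H) \<union> S)"
      using N Q S by (intro emeasure_Un_null_set) auto
    also have "\<dots> \<le> emeasure lebesgue (?Q - H) + emeasure lebesgue S"
      using Q S by (intro emeasure_subadditive)
    also have "\<dots> \<le> ennreal (measure lebesgue ?Q / 2) + ennreal (measure lebesgue ?Q / 4)"
      by (intro add_mono half S)
    also have "\<dots> = ennreal (measure lebesgue ?Q / 2 + measure lebesgue ?Q / 4)"
      by (intro ennreal_plus[symmetric]) auto
    finally have "measure lebesgue ?Q \<le> measure lebesgue ?Q / 2 + measure lebesgue ?Q / 4"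
      by (subst (asm) emeasure_eq_measure2) (auto simp: lmeasurable_open simp del: ennreal_plus)
    moreover have "0 < measure lebesgue ?Q"
      using content_ball_pos[of 1 "0::'a"] by simp
    ultimately show False
      by simp
  qed
  have dense: "\<exists>k\<ge>m. \<exists>B\<in>\<B> x. diameter B < 1 / real (Suc k) \<and>
        ennreal \<gamma> * emeasure lebesgue B \<le> emeasure lebesgue (E k \<inter> B)" if x: "x \<in> H" for x m
  proof -
    from x have "x \<in> (\<Union>k\<in>{m..}. G k)"
      unfolding H_def by blast
    then obtain k where "m \<le> k" "x \<in> G k"
      by auto
    then show ?thesis
      using EG(5) by blast
  qed
  show thesis
    by (rule that[of E H]) (intro allI ballI impI EG(1,2) dense big; assumption)+
qed

text \<open>With \<open>\<epsilon> k\<close> summable to a quarter of the measure of the unit ball, the union \<open>S\<close> of the bad sets has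
density at least \<open>\<gamma>\<close> along arbitrarily small sets at every point of \<open>H\<close>, although almost every
point outside \<open>S\<close> should see density 0.\<close>

lemma density_basis_imp_tauberian:
  fixes \<B> :: "'a::euclidean_space \<Rightarrow> 'a set set"
  assumes bf: "busemann_feller_basis \<B>" and hi: "homothecy_invariant \<B>"
    and dens: "density_basis \<B>" and \<gamma>: "0 < \<gamma>" "\<gamma> < 1"
  shows "tauberian \<B> \<gamma>"
proof (rule ccontr)
  define q where "q = measure lebesgue (ball 0 1 :: 'a set) / 4"
  have q: "0 < q"
    using content_ball_pos[of 1 "0::'a"] by (simp add: q_def)
  have pos: "0 < q * (1 / 2) ^ Suc k" for k
    using q by simp
  assume "\<not> tauberian \<B> \<gamma>"
  then obtain E H where E: "\<forall>k. E k \<in> sets lebesgue"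
      "\<forall>k. emeasure lebesgue (E k) \<le> ennreal (q * (1 / 2) ^ Suc k)"
    and H: "\<forall>x\<in>H. \<forall>m. \<exists>k\<ge>m. \<exists>B\<in>\<B> x. diameter B < 1 / real (Suc k) \<and>
        ennreal \<gamma> * emeasure lebesgue B \<le> emeasure lebesgue (E k \<inter> B)"
    and big: "\<forall>S\<in>sets lebesgue. emeasure lebesgue S \<le> ennreal q \<longrightarrow>
        \<not> (AE x in lebesgue. x \<in> H \<longrightarrow> x \<in> S)"
    by (rule not_tauberian_bad_sequence[where \<epsilon> = "\<lambda>k. q * (1 / 2) ^ Suc k",
          OF bf hi _ pos, folded q_def])
  define S where "S = (\<Union>k. E k)"
  have S: "S \<in> sets lebesgue"
    unfolding S_def using E(1) by auto
  have sums: "(\<lambda>k. q * (1 / 2) ^ Suc k) sums (q * 1)"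
    by (intro sums_mult power_half_series)
  have "emeasure lebesgue S \<le> (\<Sum>k. emeasure lebesgue (E k))"
    unfolding S_def using E(1) by (intro emeasure_subadditive_countably) auto
  also have "\<dots> \<le> (\<Sum>k. ennreal (q * (1 / 2) ^ Suc k))"
    using E(2) by (intro suminf_le) auto
  also have "\<dots> = ennreal (\<Sum>k. q * (1 / 2) ^ Suc k)"
    using q sums by (intro suminf_ennreal2) (auto simp: sums_iff)
  also have "\<dots> = ennreal q"
    using sums_unique[OF sums] by simp
  finally have "emeasure lebesgue S \<le> ennreal q" .
  moreover have "AE x in lebesgue. x \<in> H \<longrightarrow> x \<in> S"
    using density_basisD[OF bf dens S \<gamma>]
  proof eventually_elim
    case (elim x)
    show ?case
    proof (intro impI, rule ccontr)
      assume "x \<in> H" "x \<notin> S"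
      then obtain e where e: "e > 0" "\<forall>B\<in>\<B> x. diameter B < e \<longrightarrow> rel_density S B < \<gamma>"
        using elim unfolding eventually_basis_filter by auto
      obtain m where m: "1 / real (Suc m) < e"
        using e(1) nat_approx_posE by blast
      obtain k B where kB: "m \<le> k" "B \<in> \<B> x" "diameter B < 1 / real (Suc k)"
          "ennreal \<gamma> * emeasure lebesgue B \<le> emeasure lebesgue (E k \<inter> B)"
        using H \<open>x \<in> H\<close> by meson
      have B: "B \<in> basis_sets \<B>"
        using kB(2) basis_set_mem_iff[OF bf] by blast
      have "1 / real (Suc k) \<le> 1 / real (Suc m)"
        using kB(1) by (intro divide_left_mono) auto
      then have "rel_density S B < \<gamma>"
        using e(2) kB m by auto
      moreover have "emeasure lebesgue (E k \<inter> B) \<le> emeasure lebesgue (S \<inter> B)"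
        using S basis_set(3)[OF bf B] by (intro emeasure_mono) (auto simp: S_def)
      then have "\<gamma> \<le> rel_density S B"
        using kB(4) rel_density_ge_iff[OF bf B S, of \<gamma>] \<gamma> by auto
      ultimately show False
        by simp
    qed
  qed
  ultimately show False
    using big S by blast
qed

section \<open>The median maximal function\<close>

text \<open>The link between functions and sets: any estimate of halos is an estimate of the distribution
function of the median maximal function.\<close>

lemma superlevel_median_maximal_subset_halo:
  "{x. median_maximal \<gamma> \<B> f x > ereal t} \<subseteq> halo \<B> \<gamma> {x. \<bar>f x\<bar> > ereal t}"
proof
  fix x assume "x \<in> {x. median_maximal \<gamma> \<B> f x > ereal t}"
  then obtain B where B: "B \<in> basis_sets \<B>" "x \<in> B" "ereal t < median \<gamma> (\<lambda>y. \<bar>f y\<bar>) B"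
    by (auto simp: median_maximal_def less_SUP_iff)
  have "{y\<in>B. \<bar>f y\<bar> > ereal t} = {x. \<bar>f x\<bar> > ereal t} \<inter> B"
    by auto
  with less_medianD[OF B(3)] B(1,2) show "x \<in> halo \<B> \<gamma> {x. \<bar>f x\<bar> > ereal t}"
    by (auto simp: halo_def)
qed

lemma median_maximal_geI:
  assumes bf: "busemann_feller_basis \<B>" and f: "f \<in> borel_measurable lebesgue"
    and B: "B \<in> basis_sets \<B>" "x \<in> B"
    and dense: "ennreal \<gamma> * emeasure lebesgue B \<le> emeasure lebesgue (A \<inter> B)"
    and large: "\<And>y. y \<in> A \<Longrightarrow> c \<le> \<bar>f y\<bar>"
  shows "c \<le> median_maximal \<gamma> \<B> f x"
proof -
  have "c \<le> median \<gamma> (\<lambda>y. \<bar>f y\<bar>) B"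
  proof (rule median_geI)
    fix a assume "ereal a < c"
    then have "A \<inter> B \<subseteq> {y. \<bar>f y\<bar> > ereal a} \<inter> B"
      using large by (auto intro: less_le_trans)
    moreover have "{y. \<bar>f y\<bar> > ereal a} \<inter> B \<in> sets lebesgue"
      using f basis_set(3)[OF bf B(1)] by (intro sets.Int superlevel_in_sets_lebesgue) auto
    ultimately have "emeasure lebesgue (A \<inter> B) \<le> emeasure lebesgue ({y. \<bar>f y\<bar> > ereal a} \<inter> B)"
      by (rule emeasure_mono)
    also have "{y. \<bar>f y\<bar> > ereal a} \<inter> B = {y\<in>B. \<bar>f y\<bar> > ereal a}"
      by auto
    finally show "ennreal \<gamma> * emeasure lebesgue B \<le> emeasure lebesgue {y\<in>B. \<bar>f y\<bar> > ereal a}"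
      using dense by (rule order_trans[rotated])
  qed
  also have "\<dots> \<le> median_maximal \<gamma> \<B> f x"
    unfolding median_maximal_def using B by (intro SUP_upper) auto
  finally show ?thesis .
qed

lemma halo_subset_median_maximal:
  assumes "busemann_feller_basis \<B>" "f \<in> borel_measurable lebesgue" "\<And>y. y \<in> A \<Longrightarrow> c \<le> \<bar>f y\<bar>"
  shows "halo \<B> \<gamma> A \<subseteq> {x. c \<le> median_maximal \<gamma> \<B> f x}"
  unfolding halo_def using median_maximal_geI[OF assms(1,2) _ _ _ assms(3)] by blast

lemma median_maximal_nonneg:
  assumes bf: "busemann_feller_basis \<B>" and \<gamma>: "\<gamma> \<le> 1"
  shows "0 \<le> median_maximal \<gamma> \<B> f x"
proof -
  obtain B where B: "B \<in> basis_sets \<B>" "x \<in> B"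
    using bf basis_set_mem_iff[OF bf]
    unfolding busemann_feller_basis_def differentiation_basis_def by (meson zero_less_one)
  have "0 \<le> median \<gamma> (\<lambda>y. \<bar>f y\<bar>) B"
  proof (rule median_geI)
    fix a assume "ereal a < 0"
    then have "ereal a < \<bar>f y\<bar>" for y
      by (rule less_le_trans) simp
    then have "{y\<in>B. \<bar>f y\<bar> > ereal a} = B"
      by auto
    then show "ennreal \<gamma> * emeasure lebesgue B \<le> emeasure lebesgue {y\<in>B. \<bar>f y\<bar> > ereal a}"
      using \<gamma> mult_right_mono[of "ennreal \<gamma>" 1 "emeasure lebesgue B"] by simp
  qed
  also have "\<dots> \<le> median_maximal \<gamma> \<B> f x"
    unfolding median_maximal_def using B by (intro SUP_upper) auto
  finally show ?thesis .
qed

lemma borel_measurable_median_maximal: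
  fixes \<B> :: "'a::euclidean_space \<Rightarrow> 'a set set"
  assumes "busemann_feller_basis \<B>"
  shows "median_maximal \<gamma> \<B> f \<in> borel_measurable lebesgue"
proof -
  have "median_maximal \<gamma> \<B> f \<in> borel_measurable borel"
    using open_median_maximal_superlevel[OF assms]
    by (intro borel_measurableI_greater) (simp add: borel_open)
  then show ?thesis
    by (simp add: measurable_completion)
qed

lemma tauberian_superlevel:
  fixes \<B> :: "'a::euclidean_space \<Rightarrow> 'a set set"
  assumes bf: "busemann_feller_basis \<B>" and taub: "tauberian \<B> \<gamma>"
  obtains C :: real where "0 < C"
    "\<forall>f\<in>borel_measurable lebesgue. \<forall>t::real.
       emeasure lebesgue {x. median_maximal \<gamma> \<B> f x > ereal t}
         \<le> ennreal C * emeasure lebesgue {x. \<bar>f x\<bar> > ereal t}"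
proof -
  obtain C :: real where C: "\<And>A. A \<in> sets lebesgue \<Longrightarrow>
      emeasure lebesgue (halo \<B> \<gamma> A) \<le> ennreal C * emeasure lebesgue A"
    using taub unfolding tauberian_def by blast
  show thesis
  proof
    \<comment> \<open>Positivity matters where a power of \<open>C * I\<close> with \<open>I = \<infinity>\<close> is split into factors.\<close>
    show "0 < max C 1"
      by simp
    show "\<forall>f\<in>borel_measurable lebesgue. \<forall>t::real.
       emeasure lebesgue {x. median_maximal \<gamma> \<B> f x > ereal t}
         \<le> ennreal (max C 1) * emeasure lebesgue {x. \<bar>f x\<bar> > ereal t}"
    proof (intro ballI allI)
      fix f :: "'a \<Rightarrow> ereal" and t :: real
      assume f: "f \<in> borel_measurable lebesgue"
      have "emeasure lebesgue {x. median_maximal \<gamma> \<B> f x > ereal t}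
          \<le> emeasure lebesgue (halo \<B> \<gamma> {x. \<bar>f x\<bar> > ereal t})"
        by (intro emeasure_mono superlevel_median_maximal_subset_halo open_in_sets_lebesgue open_halo bf)
      also have "\<dots> \<le> ennreal C * emeasure lebesgue {x. \<bar>f x\<bar> > ereal t}"
        using f by (intro C superlevel_in_sets_lebesgue) measurable
      also have "\<dots> \<le> ennreal (max C 1) * emeasure lebesgue {x. \<bar>f x\<bar> > ereal t}"
        by (intro mult_right_mono ennreal_leI) auto
      finally show "emeasure lebesgue {x. median_maximal \<gamma> \<B> f x > ereal t}
           \<le> ennreal (max C 1) * emeasure lebesgue {x. \<bar>f x\<bar> > ereal t}" .
    qed
  qed
qed

section \<open>Powers and the distribution function\<close>

lemma ennreal_powr_ennreal: "0 \<le> r \<Longrightarrow> ennreal_powr (ennreal r) p = ennreal (r powr p)"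
  by (simp add: ennreal_powr_def)

lemma ennreal_powr_top: "ennreal_powr top p = top"
  by (simp add: ennreal_powr_def)

lemma ennreal_powr_eq_top_iff: "ennreal_powr a p = top \<longleftrightarrow> a = top"
  by (simp add: ennreal_powr_def)

lemma ennreal_powr_mono:
  assumes "a \<le> b" "0 \<le> p"
  shows "ennreal_powr a p \<le> ennreal_powr b p"
proof (cases b)
  case (real r)
  then obtain s where "a = ennreal s" "0 \<le> s" "s \<le> r"
    using assms(1) by (cases a) (auto simp: top_unique)
  then show ?thesis
    using real assms(2) by (simp add: ennreal_powr_ennreal ennreal_leI powr_mono2)
qed (simp add: ennreal_powr_top)

lemma ennreal_powr_powr: "ennreal_powr (ennreal_powr a p) q = ennreal_powr a (p * q)"
  by (cases a) (simp_all add: ennreal_powr_ennreal ennreal_powr_top powr_powr)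

lemma ennreal_powr_one [simp]: "ennreal_powr a 1 = a"
  by (cases a) (simp_all add: ennreal_powr_ennreal ennreal_powr_top)

lemma ennreal_powr_le_iff:
  assumes "0 < p"
  shows "ennreal_powr a p \<le> b \<longleftrightarrow> a \<le> ennreal_powr b (1 / p)"
  using assms ennreal_powr_mono[of "ennreal_powr a p" b "1 / p"]
    ennreal_powr_mono[of a "ennreal_powr b (1 / p)" p]
  by (auto simp: ennreal_powr_powr)

lemma ennreal_powr_mult:
  assumes "0 < c"
  shows "ennreal_powr (ennreal c * a) p = ennreal (c powr p) * ennreal_powr a p"
  using assms
  by (cases a) (simp_all add: ennreal_powr_ennreal ennreal_powr_top ennreal_mult[symmetric] powr_mult
      ennreal_mult_top)

lemma measurable_ennreal_powr [measurable]: "(\<lambda>a. ennreal_powr a p) \<in> borel_measurable borel"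
  unfolding ennreal_powr_def by measurable

lemma less_e2ennreal_iff: "0 \<le> s \<Longrightarrow> ennreal s < e2ennreal y \<longleftrightarrow> ereal s < y"
  by (cases y) (auto simp: ennreal_less_iff e2ennreal_neg ennreal.rep_eq not_less ereal_less)

lemma sigma_finite_lebesgue: "sigma_finite_measure (lebesgue :: 'a::euclidean_space measure)"
proof
  show "\<exists>A. countable A \<and> A \<subseteq> sets lebesgue \<and> \<Union> A = space (lebesgue :: 'a measure) \<and>
      (\<forall>a\<in>A. emeasure lebesgue a \<noteq> \<infinity>)"
  proof (intro exI conjI ballI)
    let ?A = "range (\<lambda>n::nat. ball (0::'a) (real n))"
    show "countable ?A" "?A \<subseteq> sets lebesgue"
      by auto
    show "\<Union> ?A = space lebesgue"
      using reals_Archimedean2 by auto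
    fix a assume "a \<in> ?A"
    then obtain n :: nat where "a = ball 0 (real n)"
      by auto
    then show "emeasure lebesgue a \<noteq> \<infinity>"
      using emeasure_lborel_ball_finite[of "0::'a" "real n"] by simp
  qed
qed

text \<open>Every \<open>a \<in> [0, \<infinity>]\<close> is the length of the interval of positive reals below it, infinite values
included.  The integrand is a product so that Fubini's theorem applies to it directly.\<close>

lemma emeasure_lborel_below:
  "(\<integral>\<^sup>+s. indicator {0::real<..} s * indicator {s. ennreal s < a} s \<partial>lborel) = a"
proof -
  have "(\<integral>\<^sup>+s. indicator {0::real<..} s * indicator {s. ennreal s < a} s \<partial>lborel)
      = (\<integral>\<^sup>+s. indicator {s. 0 < s \<and> ennreal s < a} s \<partial>lborel)"
    by (intro nn_integral_cong) (simp split: split_indicator)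
  also have "\<dots> = emeasure lborel {s. 0 < s \<and> ennreal s < a}"
    by (intro nn_integral_indicator) simp
  also have "\<dots> = a"
  proof (cases a)
    case (real r)
    then have "{s. 0 < s \<and> ennreal s < a} = {0<..<r}"
      by (auto simp: ennreal_less_iff)
    then show ?thesis
      using real by simp
  next
    case top
    have "{s. 0 < s \<and> ennreal s < a} = {0<..}"
      using top by auto
    moreover have "emeasure lborel {0::real<..} = top"
    proof (rule ccontr)
      assume "emeasure lborel {0::real<..} \<noteq> top"
      then obtain r where r: "0 \<le> r" "emeasure lborel {0::real<..} = ennreal r"
        by (cases "emeasure lborel {0::real<..}") auto
      obtain n :: nat where n: "r < real n"
        using reals_Archimedean2 by blast
      have "emeasure lborel {0<..<real n} \<le> emeasure lborel {0::real<..}"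
        by (intro emeasure_mono) auto
      with r n show False
        by (simp add: ennreal_le_iff)
    qed
    ultimately show ?thesis
      using top by simp
  qed
  finally show ?thesis .
qed

lemma nn_integral_distribution:
  assumes "sigma_finite_measure M" and [measurable]: "g \<in> borel_measurable M"
  shows "(\<integral>\<^sup>+x. g x \<partial>M)
    = (\<integral>\<^sup>+s. indicator {0::real<..} s * emeasure M {x\<in>space M. ennreal s < g x} \<partial>lborel)"
proof -
  interpret sigma_finite_measure M by fact
  interpret pair_sigma_finite M "lborel :: real measure" ..
  have "(\<integral>\<^sup>+x. g x \<partial>M)
      = (\<integral>\<^sup>+x. \<integral>\<^sup>+s. indicator {0::real<..} s * indicator {s. ennreal s < g x} s \<partial>lborel \<partial>M)"
    by (simp only: emeasure_lborel_below)
  also have "\<dots> = (\<integral>\<^sup>+s. \<integral>\<^sup>+x. indicator {0::real<..} s * indicator {s. ennreal s < g x} s \<partial>M \<partial>lborel)"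
    by (rule Fubini'[symmetric]) measurable
  also have "\<dots> = (\<integral>\<^sup>+s. indicator {0::real<..} s * emeasure M {x\<in>space M. ennreal s < g x} \<partial>lborel)"
  proof (rule nn_integral_cong)
    fix s :: real
    have "(\<integral>\<^sup>+x. indicator {0::real<..} s * indicator {s. ennreal s < g x} s \<partial>M)
        = (\<integral>\<^sup>+x. indicator {0::real<..} s * indicator {x\<in>space M. ennreal s < g x} x \<partial>M)"
      by (intro nn_integral_cong) (simp split: split_indicator)
    then show "(\<integral>\<^sup>+x. indicator {0::real<..} s * indicator {s. ennreal s < g x} s \<partial>M)
        = indicator {0::real<..} s * emeasure M {x\<in>space M. ennreal s < g x}"
      by (simp add: nn_integral_cmult)
  qed
  finally show ?thesis .
qed

text \<open>By the layer cake formula \<open>nn_integral_distribution\<close>, an inequality between distribution functions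
integrates to an inequality between integrals with the same constant.\<close>

lemma nn_integral_le_if_superlevel_le:
  assumes sf: "sigma_finite_measure M" and g: "g \<in> borel_measurable M" and h: "h \<in> borel_measurable M"
    and le: "\<And>s::real. 0 < s \<Longrightarrow> emeasure M {x\<in>space M. ennreal s < g x}
      \<le> c * emeasure M {x\<in>space M. ennreal s < h x}"
  shows "(\<integral>\<^sup>+x. g x \<partial>M) \<le> c * (\<integral>\<^sup>+x. h x \<partial>M)"
proof -
  interpret sigma_finite_measure M by fact
  note [measurable] = h
  have [measurable]: "(\<lambda>s::real. emeasure M {x\<in>space M. ennreal s < h x}) \<in> borel_measurable lborel"
    by measurable
  have "(\<integral>\<^sup>+x. g x \<partial>M)
      \<le> (\<integral>\<^sup>+s. c * (indicator {0::real<..} s * emeasure M {x\<in>space M. ennreal s < h x}) \<partial>lborel)"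
    unfolding nn_integral_distribution[OF sf g]
    by (intro nn_integral_mono) (use le in \<open>auto split: split_indicator\<close>)
  also have "\<dots> = c * (\<integral>\<^sup>+x. h x \<partial>M)"
    unfolding nn_integral_distribution[OF sf h] by (rule nn_integral_cmult) measurable
  finally show ?thesis .
qed

section \<open>Norm inequalities\<close>

text \<open>The weak type estimate compares the superlevel sets of both functions at the same height, so it
passes to their \<open>p\<close>-th powers with the same constant and can then be integrated.  This gives every
exponent \<open>p > 0\<close>, without interpolation.\<close>

lemma tauberian_imp_Lp_bound:
  fixes \<B> :: "'a::euclidean_space \<Rightarrow> 'a set set"
  assumes bf: "busemann_feller_basis \<B>" and taub: "tauberian \<B> \<gamma>" and \<gamma>: "\<gamma> < 1" and p: "0 < p"
  shows "\<exists>C::real. \<forall>f\<in>Lp p. Lp_norm p (median_maximal \<gamma> \<B> f) \<le> ennreal C * Lp_norm p f"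
proof -
  obtain C :: real where C: "0 < C"
    and weak: "\<forall>f\<in>borel_measurable lebesgue. \<forall>t::real.
       emeasure lebesgue {x. median_maximal \<gamma> \<B> f x > ereal t}
         \<le> ennreal C * emeasure lebesgue {x. \<bar>f x\<bar> > ereal t}"
    by (rule tauberian_superlevel[OF bf taub])
  have "Lp_norm p (median_maximal \<gamma> \<B> f) \<le> ennreal (C powr (1 / p)) * Lp_norm p f" if "f \<in> Lp p" for f
  proof -
    have f [measurable]: "f \<in> borel_measurable lebesgue"
      using that by (simp add: Lp_def)
    note [measurable] = borel_measurable_median_maximal[OF bf]
    have level: "ennreal s < ennreal_powr (e2ennreal y) p \<longleftrightarrow> ereal (s powr (1 / p)) < y"
      if "0 < s" for s y
      using ennreal_powr_le_iff[OF p, of "e2ennreal y" "ennreal s"]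
        less_e2ennreal_iff[of "s powr (1 / p)" y] that
      by (simp add: ennreal_powr_ennreal not_le[symmetric])
    have nonneg: "\<bar>median_maximal \<gamma> \<B> f x\<bar> = median_maximal \<gamma> \<B> f x" for x
      using median_maximal_nonneg[OF bf, of \<gamma> f x] \<gamma> by simp
    have "(\<integral>\<^sup>+x. ennreal_powr (e2ennreal \<bar>median_maximal \<gamma> \<B> f x\<bar>) p \<partial>lebesgue)
        \<le> ennreal C * (\<integral>\<^sup>+x. ennreal_powr (e2ennreal \<bar>f x\<bar>) p \<partial>lebesgue)"
    proof (rule nn_integral_le_if_superlevel_le[OF sigma_finite_lebesgue])
      show "(\<lambda>x. ennreal_powr (e2ennreal \<bar>median_maximal \<gamma> \<B> f x\<bar>) p) \<in> borel_measurable lebesgue"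
        by measurable
      show "(\<lambda>x. ennreal_powr (e2ennreal \<bar>f x\<bar>) p) \<in> borel_measurable lebesgue"
        by measurable
      fix s :: real assume s: "0 < s"
      have "{x\<in>space lebesgue. ennreal s < ennreal_powr (e2ennreal \<bar>median_maximal \<gamma> \<B> f x\<bar>) p}
          = {x. median_maximal \<gamma> \<B> f x > ereal (s powr (1 / p))}"
        unfolding level[OF s] nonneg by simp
      moreover have "{x\<in>space lebesgue. ennreal s < ennreal_powr (e2ennreal \<bar>f x\<bar>) p}
          = {x. \<bar>f x\<bar> > ereal (s powr (1 / p))}"
        unfolding level[OF s] by simp
      ultimately show "emeasure lebesgue {x\<in>space lebesgue. ennreal s < ennreal_powr (e2ennreal \<bar>median_maximal \<gamma> \<B> f x\<bar>) p}
          \<le> ennreal C * emeasure lebesgue {x\<in>space lebesgue. ennreal s < ennreal_powr (e2ennreal \<bar>f x\<bar>) p}"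
        using weak f by (simp only:)
    qed
    then have "Lp_norm p (median_maximal \<gamma> \<B> f)
        \<le> ennreal_powr (ennreal C * (\<integral>\<^sup>+x. ennreal_powr (e2ennreal \<bar>f x\<bar>) p \<partial>lebesgue)) (1 / p)"
      unfolding Lp_norm_def using p by (intro ennreal_powr_mono) auto
    also have "\<dots> = ennreal (C powr (1 / p)) * Lp_norm p f"
      unfolding Lp_norm_def by (rule ennreal_powr_mult[OF C])
    finally show ?thesis .
  qed
  then show ?thesis
    by (intro exI[of _ "C powr (1 / p)"] ballI)
qed

lemma Lp_norm_1: "Lp_norm 1 f = (\<integral>\<^sup>+x. e2ennreal \<bar>f x\<bar> \<partial>lebesgue)"
  by (simp add: Lp_norm_def)

lemma L1_bound_imp_convergence_in_measure:
  fixes \<B> :: "'a::euclidean_space \<Rightarrow> 'a set set" and C t :: real and f :: "nat \<Rightarrow> 'a \<Rightarrow> ereal"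
  assumes bf: "busemann_feller_basis \<B>" and t: "0 < t"
    and bound: "\<And>f. f \<in> Lp 1 \<Longrightarrow> Lp_norm 1 (median_maximal \<gamma> \<B> f) \<le> ennreal C * Lp_norm 1 f"
    and f: "\<And>k. f k \<in> Lp 1" "(\<lambda>k. Lp_norm 1 (f k)) \<longlonglongrightarrow> 0"
  shows "(\<lambda>k. emeasure lebesgue {x. median_maximal \<gamma> \<B> (f k) x > ereal t}) \<longlonglongrightarrow> 0"
proof (rule tendsto_sandwich[of "\<lambda>_. 0"])
  note [measurable] = borel_measurable_median_maximal[OF bf]
  have "emeasure lebesgue {x. median_maximal \<gamma> \<B> (f k) x > ereal t}
      \<le> ennreal (1 / t) * (ennreal C * Lp_norm 1 (f k))" for k
  proof -
    have "1 \<le> ennreal (1 / t) * e2ennreal \<bar>y\<bar>" if "ereal t < y" for y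
    proof -
      have "ereal t < \<bar>y\<bar>"
        using that by (cases y) auto
      then have "ennreal t \<le> e2ennreal \<bar>y\<bar>"
        using t less_e2ennreal_iff[of t "\<bar>y\<bar>"] by simp
      then have "ennreal (1 / t) * ennreal t \<le> ennreal (1 / t) * e2ennreal \<bar>y\<bar>"
        by (rule mult_left_mono) simp
      then show ?thesis
        using t by (simp add: ennreal_mult[symmetric])
    qed
    moreover have "{x\<in>space lebesgue. 1 \<le> ennreal (1 / t) * e2ennreal \<bar>median_maximal \<gamma> \<B> (f k) x\<bar>} \<in> sets lebesgue"
      by measurable
    ultimately have "emeasure lebesgue {x. median_maximal \<gamma> \<B> (f k) x > ereal t}
        \<le> emeasure lebesgue {x\<in>space lebesgue. 1 \<le> ennreal (1 / t) * e2ennreal \<bar>median_maximal \<gamma> \<B> (f k) x\<bar>}"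
      by (intro emeasure_mono) auto
    also have "\<dots> \<le> ennreal (1 / t) *
        (\<integral>\<^sup>+x. e2ennreal \<bar>median_maximal \<gamma> \<B> (f k) x\<bar> * indicator (space lebesgue) x \<partial>lebesgue)"
      by (rule nn_integral_Markov_inequality) measurable
    also have "\<dots> = ennreal (1 / t) * Lp_norm 1 (median_maximal \<gamma> \<B> (f k))"
      by (simp add: Lp_norm_1)
    also have "\<dots> \<le> ennreal (1 / t) * (ennreal C * Lp_norm 1 (f k))"
      by (intro mult_left_mono bound f) simp
    finally show ?thesis .
  qed
  then show "\<forall>\<^sub>F k in sequentially. emeasure lebesgue {x. median_maximal \<gamma> \<B> (f k) x > ereal t}
      \<le> ennreal (1 / t) * (ennreal C * Lp_norm 1 (f k))"
    by simp
  have "(\<lambda>k. ennreal (1 / t) * (ennreal C * Lp_norm 1 (f k))) \<longlonglongrightarrow> ennreal (1 / t) * (ennreal C * 0)"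
    by (intro ennreal_tendsto_cmult f) auto
  then show "(\<lambda>k. ennreal (1 / t) * (ennreal C * Lp_norm 1 (f k))) \<longlonglongrightarrow> 0"
    by simp
qed simp_all

lemma L1_bound_imp_finite:
  fixes \<B> :: "'a::euclidean_space \<Rightarrow> 'a set set"
  assumes bf: "busemann_feller_basis \<B>" and f: "f \<in> Lp 1"
    and bound: "Lp_norm 1 (median_maximal \<gamma> \<B> f) \<le> ennreal C * Lp_norm 1 f"
  shows "AE x in lebesgue. median_maximal \<gamma> \<B> f x < \<infinity>"
proof -
  note [measurable] = borel_measurable_median_maximal[OF bf]
  have "ennreal C * Lp_norm 1 f < top"
    using f by (simp add: Lp_def ennreal_mult_less_top)
  with bound have "(\<integral>\<^sup>+x. e2ennreal \<bar>median_maximal \<gamma> \<B> f x\<bar> \<partial>lebesgue) \<noteq> \<infinity>"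
    unfolding Lp_norm_1 by auto
  then have "AE x in lebesgue. e2ennreal \<bar>median_maximal \<gamma> \<B> f x\<bar> \<noteq> \<infinity>"
    by (intro nn_integral_PInf_AE) measurable
  then show ?thesis
    by eventually_elim (auto simp: less_top)
qed

section \<open>Recovering the halo estimate\<close>

text \<open>For \<open>f = 2\<close> on \<open>A\<close> and 0 elsewhere the median maximal function is at least 2 on the halo of \<open>A\<close>,
hence above the level 1, while \<open>A\<close> itself is the superlevel set of \<open>f\<close>.\<close>

lemma weak_type_imp_tauberian:
  fixes \<B> :: "'a::euclidean_space \<Rightarrow> 'a set set"
  assumes bf: "busemann_feller_basis \<B>"
    and weak: "\<And>f. f \<in> L0 \<Longrightarrow> emeasure lebesgue {x. median_maximal \<gamma> \<B> f x > ereal 1}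
              \<le> ennreal C * emeasure lebesgue {x. \<bar>f x\<bar> > ereal 1}"
  shows "tauberian \<B> \<gamma>"
  unfolding tauberian_def
proof (intro exI ballI)
  fix A :: "'a set" assume A [measurable]: "A \<in> sets lebesgue"
  define f :: "'a \<Rightarrow> ereal" where "f = (\<lambda>x. if x \<in> A then 2 else 0)"
  have f: "f \<in> L0"
    unfolding L0_def f_def by auto
  have "halo \<B> \<gamma> A \<subseteq> {x. 2 \<le> median_maximal \<gamma> \<B> f x}"
    using f by (intro halo_subset_median_maximal bf) (auto simp: L0_def f_def)
  also have "\<dots> \<subseteq> {x. median_maximal \<gamma> \<B> f x > ereal 1}"
    by (auto intro: less_le_trans[of _ 2])
  finally have "emeasure lebesgue (halo \<B> \<gamma> A) \<le> emeasure lebesgue {x. median_maximal \<gamma> \<B> f x > ereal 1}"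
    by (intro emeasure_mono open_in_sets_lebesgue open_median_maximal_superlevel bf)
  also have "\<dots> \<le> ennreal C * emeasure lebesgue {x. \<bar>f x\<bar> > ereal 1}"
    by (rule weak[OF f])
  also have "{x. \<bar>f x\<bar> > ereal 1} = A"
    by (auto simp: f_def)
  finally show "emeasure lebesgue (halo \<B> \<gamma> A) \<le> ennreal C * emeasure lebesgue A" .
qed

text \<open>The Tauberian inequality is invariant under dilations, so a set of positive finite measure may be
rescaled to measure exactly \<open>\<delta>\<close>.\<close>

lemma small_sets_imp_tauberian:
  fixes \<B> :: "'a::euclidean_space \<Rightarrow> 'a set set" and \<delta> :: real
  assumes bf: "busemann_feller_basis \<B>" and hi: "homothecy_invariant \<B>" and "0 < \<gamma>" and \<delta>: "0 < \<delta>"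
    and small: "\<And>A. A \<in> sets lebesgue \<Longrightarrow> emeasure lebesgue A \<le> ennreal \<delta> \<Longrightarrow>
      emeasure lebesgue (halo \<B> \<gamma> A) \<le> 1"
  shows "tauberian \<B> \<gamma>"
  unfolding tauberian_def
proof (intro exI ballI)
  fix A :: "'a set" assume A: "A \<in> sets lebesgue"
  show "emeasure lebesgue (halo \<B> \<gamma> A) \<le> ennreal (1 / \<delta>) * emeasure lebesgue A"
  proof (cases "emeasure lebesgue A = 0 \<or> emeasure lebesgue A = top")
    case True
    then show ?thesis
      using halo_null[OF bf \<open>0 < \<gamma>\<close> _ A] \<delta> by (auto simp: ennreal_mult_top)
  next
    case False
    then obtain \<alpha> where \<alpha>: "emeasure lebesgue A = ennreal \<alpha>" "0 < \<alpha>"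
      by (cases "emeasure lebesgue A") (auto simp: less_le)
    define t where "t = root DIM('a) (\<delta> / \<alpha>)"
    have t: "0 < t" "t ^ DIM('a) = \<delta> / \<alpha>"
      using \<alpha> \<delta> by (auto simp: t_def)
    have "emeasure lebesgue (homothety 0 t ` A) = ennreal \<delta>"
      unfolding emeasure_homothety[OF t(1)] \<alpha>(1) t(2)
      using \<alpha>(2) \<delta> by (simp add: ennreal_mult[symmetric])
    then have "emeasure lebesgue (halo \<B> \<gamma> (homothety 0 t ` A)) \<le> 1"
      by (intro small homothety_in_sets_lebesgue A t) simp
    moreover have "emeasure lebesgue (homothety 0 t ` halo \<B> \<gamma> A)
        \<le> emeasure lebesgue (halo \<B> \<gamma> (homothety 0 t ` A))"
      by (intro emeasure_mono homothety_halo_subset hi t open_in_sets_lebesgue open_halo bf)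
    ultimately have le1: "ennreal (\<delta> / \<alpha>) * emeasure lebesgue (halo \<B> \<gamma> A) \<le> 1"
      unfolding emeasure_homothety[OF t(1)] t(2) by (rule order_trans[rotated])
    have "emeasure lebesgue (halo \<B> \<gamma> A)
        = ennreal (\<alpha> / \<delta>) * (ennreal (\<delta> / \<alpha>) * emeasure lebesgue (halo \<B> \<gamma> A))"
      using \<alpha>(2) \<delta> by (simp add: mult.assoc[symmetric] ennreal_mult[symmetric])
    also have "\<dots> \<le> ennreal (\<alpha> / \<delta>) * 1"
      using le1 by (rule mult_left_mono) simp
    also have "\<dots> = ennreal (1 / \<delta>) * emeasure lebesgue A"
      using \<alpha> \<delta> by (simp add: ennreal_mult[symmetric])
    finally show ?thesis .
  qed
qed

text \<open>If arbitrarily small sets had halos of measure more than 1, doubled indicator functions of such sets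
would tend to 0 in \<open>L\<^sup>p\<close> while their median maximal functions exceed 1 on these halos.\<close>

lemma convergence_in_measure_imp_tauberian:
  fixes \<B> :: "'a::euclidean_space \<Rightarrow> 'a set set"
  assumes bf: "busemann_feller_basis \<B>" and hi: "homothecy_invariant \<B>" and \<gamma>: "0 < \<gamma>" and p: "0 < p"
    and conv: "\<And>f. (\<And>k. f k \<in> Lp p) \<Longrightarrow> (\<lambda>k. Lp_norm p (f k)) \<longlonglongrightarrow> 0 \<Longrightarrow>
       (\<lambda>k. emeasure lebesgue {x. median_maximal \<gamma> \<B> (f k) x > ereal 1}) \<longlonglongrightarrow> 0"
  shows "tauberian \<B> \<gamma>"
proof (rule ccontr)
  assume not_taub: "\<not> tauberian \<B> \<gamma>"
  \<comment> \<open>Sets of this measure make the norm of the doubled indicator function at most \<open>1 / (k + 1)\<close>.\<close>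
  define \<delta> where "\<delta> = (\<lambda>k::nat. (1 / real (Suc k)) powr p / 2 powr p)"
  have \<delta>: "0 < \<delta> k" for k
    by (simp add: \<delta>_def)
  have "\<exists>A. A \<in> sets lebesgue \<and> emeasure lebesgue A \<le> ennreal (\<delta> k) \<and> 1 < emeasure lebesgue (halo \<B> \<gamma> A)" for k
    using small_sets_imp_tauberian[OF bf hi \<gamma> \<delta>[of k]] not_taub by (meson not_le)
  then obtain A where A: "\<And>k. A k \<in> sets lebesgue" "\<And>k. emeasure lebesgue (A k) \<le> ennreal (\<delta> k)"
      "\<And>k. 1 < emeasure lebesgue (halo \<B> \<gamma> (A k))"
    by metis
  define f :: "nat \<Rightarrow> 'a \<Rightarrow> ereal" where "f = (\<lambda>k x. if x \<in> A k then 2 else 0)"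
  note [measurable] = A(1)
  have f: "f k \<in> borel_measurable lebesgue" for k
    unfolding f_def by measurable
  have norm: "Lp_norm p (f k) \<le> ennreal (1 / real (Suc k))" for k
  proof -
    have "ennreal_powr (e2ennreal \<bar>f k x\<bar>) p = ennreal (2 powr p) * indicator (A k) x" for x
      using p ennreal_powr_ennreal[of 2 p] ennreal_powr_ennreal[of 0 p]
      by (simp add: f_def e2ennreal_neg split: split_indicator)
    then have "(\<integral>\<^sup>+x. ennreal_powr (e2ennreal \<bar>f k x\<bar>) p \<partial>lebesgue) = ennreal (2 powr p) * emeasure lebesgue (A k)"
      by (simp add: nn_integral_cmult A(1))
    also have "\<dots> \<le> ennreal (2 powr p) * ennreal (\<delta> k)"
      by (intro mult_left_mono A) simp
    also have "\<dots> = ennreal ((1 / real (Suc k)) powr p)"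
      by (simp add: ennreal_mult[symmetric] \<delta>_def)
    also have "\<dots> = ennreal_powr (ennreal (1 / real (Suc k))) p"
      by (simp add: ennreal_powr_ennreal)
    finally have "Lp_norm p (f k) \<le> ennreal_powr (ennreal_powr (ennreal (1 / real (Suc k))) p) (1 / p)"
      unfolding Lp_norm_def using p by (intro ennreal_powr_mono) auto
    then show ?thesis
      using p by (simp add: ennreal_powr_powr)
  qed
  have "f k \<in> Lp p" for k
    using f norm[of k] by (auto simp: Lp_def intro: le_less_trans)
  moreover have "(\<lambda>k. Lp_norm p (f k)) \<longlonglongrightarrow> 0"
  proof (rule tendsto_sandwich[of "\<lambda>_. 0"])
    show "(\<lambda>k. ennreal (1 / real (Suc k))) \<longlonglongrightarrow> 0"
      using LIMSEQ_inverse_real_of_nat by (simp add: ennreal_tendsto_0_iff inverse_eq_divide)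
  qed (use norm in auto)
  ultimately have "(\<lambda>k. emeasure lebesgue {x. median_maximal \<gamma> \<B> (f k) x > ereal 1}) \<longlonglongrightarrow> 0"
    by (rule conv)
  then have "\<forall>\<^sub>F k in sequentially. emeasure lebesgue {x. median_maximal \<gamma> \<B> (f k) x > ereal 1} < 1"
    by (rule order_tendstoD(2)) simp
  then obtain k where k: "emeasure lebesgue {x. median_maximal \<gamma> \<B> (f k) x > ereal 1} < 1"
    by (auto simp: eventually_sequentially)
  have "halo \<B> \<gamma> (A k) \<subseteq> {x. 2 \<le> median_maximal \<gamma> \<B> (f k) x}"
    by (intro halo_subset_median_maximal bf f) (auto simp: f_def)
  also have "\<dots> \<subseteq> {x. median_maximal \<gamma> \<B> (f k) x > ereal 1}"
    by (auto intro: less_le_trans[of _ 2])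
  finally have "emeasure lebesgue (halo \<B> \<gamma> (A k)) \<le> emeasure lebesgue {x. median_maximal \<gamma> \<B> (f k) x > ereal 1}"
    by (intro emeasure_mono open_in_sets_lebesgue open_median_maximal_superlevel bf)
  with k A(3)[of k] show False
    by simp
qed

text \<open>Superpose the bad sets with heights growing to infinity: \<open>f\<close> is at least \<open>k\<close> on \<open>E k\<close>, and the measures
\<open>\<epsilon> k\<close> are chosen so small that \<open>f\<close> still belongs to \<open>L\<^sup>p\<close>.  Every point of \<open>H\<close> lies in sets of
\<open>\<B>\<close> in which infinitely many of the \<open>E k\<close> occupy the portion \<open>\<gamma>\<close>, so the median maximal function
is infinite there.  The function is defined through its \<open>p\<close>-th power \<open>g\<close>, for which the integral of
the series is a series of integrals.\<close>

lemma finite_imp_tauberian: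
  fixes \<B> :: "'a::euclidean_space \<Rightarrow> 'a set set"
  assumes bf: "busemann_feller_basis \<B>" and hi: "homothecy_invariant \<B>" and p: "0 < p"
    and fin: "\<And>f. f \<in> Lp p \<Longrightarrow> AE x in lebesgue. median_maximal \<gamma> \<B> f x < \<infinity>"
  shows "tauberian \<B> \<gamma>"
proof (rule ccontr)
  \<comment> \<open>The added 1 only keeps the denominator positive at \<open>k = 0\<close>.\<close>
  define \<epsilon> where "\<epsilon> = (\<lambda>k::nat. (1 / 2) ^ Suc k / (real k powr p + 1))"
  have \<epsilon>: "0 < \<epsilon> k" for k
    unfolding \<epsilon>_def by (intro divide_pos_pos add_nonneg_pos) auto
  assume "\<not> tauberian \<B> \<gamma>"
  then obtain E H where E: "\<forall>k. E k \<in> sets lebesgue" "\<forall>k. emeasure lebesgue (E k) \<le> ennreal (\<epsilon> k)"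
    and H: "\<forall>x\<in>H. \<forall>m. \<exists>k\<ge>m. \<exists>B\<in>\<B> x. diameter B < 1 / real (Suc k) \<and>
        ennreal \<gamma> * emeasure lebesgue B \<le> emeasure lebesgue (E k \<inter> B)"
    and big: "\<forall>S\<in>sets lebesgue.
        emeasure lebesgue S \<le> ennreal (measure lebesgue (ball 0 1 :: 'a set) / 4) \<longrightarrow>
        \<not> (AE x in lebesgue. x \<in> H \<longrightarrow> x \<in> S)"
    by (rule not_tauberian_bad_sequence[where \<epsilon> = \<epsilon>, OF bf hi _ \<epsilon>])
  have [measurable]: "E k \<in> sets lebesgue" for k
    using E by blast
  define g :: "'a \<Rightarrow> ennreal" where "g = (\<lambda>x. \<Sum>k. ennreal (real k powr p) * indicator (E k) x)"
  define f :: "'a \<Rightarrow> ereal" where "f = (\<lambda>x. enn2ereal (ennreal_powr (g x) (1 / p)))"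
  have g [measurable]: "g \<in> borel_measurable lebesgue"
    unfolding g_def by measurable
  have f [measurable]: "f \<in> borel_measurable lebesgue"
    unfolding f_def by measurable
  have "(\<integral>\<^sup>+x. g x \<partial>lebesgue) = (\<Sum>k. \<integral>\<^sup>+x. ennreal (real k powr p) * indicator (E k) x \<partial>lebesgue)"
    unfolding g_def by (intro nn_integral_suminf) measurable
  also have "\<dots> \<le> (\<Sum>k. ennreal ((1 / 2) ^ Suc k))"
  proof (intro suminf_le)
    fix k
    have "(\<integral>\<^sup>+x. ennreal (real k powr p) * indicator (E k) x \<partial>lebesgue)
        = ennreal (real k powr p) * emeasure lebesgue (E k)"
      using E by (simp add: nn_integral_cmult)
    also have "\<dots> \<le> ennreal (real k powr p) * ennreal (\<epsilon> k)"
      using E by (intro mult_left_mono) auto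
    also have "\<dots> = ennreal (real k powr p * \<epsilon> k)"
      using less_imp_le[OF \<epsilon>] by (simp add: ennreal_mult)
    also have "\<dots> \<le> ennreal ((1 / 2) ^ Suc k)"
    proof (rule ennreal_leI)
      have "real k powr p * \<epsilon> k \<le> (real k powr p + 1) * \<epsilon> k"
        using less_imp_le[OF \<epsilon>] by (intro mult_right_mono) auto
      also have "\<dots> = (1 / 2) ^ Suc k"
      proof -
        have "real k powr p + 1 \<noteq> 0"
          using powr_ge_zero[of "real k" p] by linarith
        then show ?thesis
          unfolding \<epsilon>_def times_divide_eq_right by (rule nonzero_mult_div_cancel_left)
      qed
      finally show "real k powr p * \<epsilon> k \<le> (1 / 2) ^ Suc k" .
    qed
    finally show "(\<integral>\<^sup>+x. ennreal (real k powr p) * indicator (E k) x \<partial>lebesgue) \<le> ennreal ((1 / 2) ^ Suc k)" .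
  qed simp_all
  also have "\<dots> = ennreal (\<Sum>k. (1 / 2) ^ Suc k)"
    using power_half_series by (intro suminf_ennreal2) (auto simp: sums_iff)
  finally have "(\<integral>\<^sup>+x. g x \<partial>lebesgue) < top"
    using le_less_trans by fastforce
  moreover have "ennreal_powr (e2ennreal \<bar>f x\<bar>) p = g x" for x
    using p by (simp add: f_def ennreal_powr_powr)
  ultimately have "f \<in> Lp p"
    using f by (simp add: Lp_def Lp_norm_def ennreal_powr_eq_top_iff less_top[symmetric])
  then have "AE x in lebesgue. median_maximal \<gamma> \<B> f x < \<infinity>"
    by (rule fin)
  moreover have "median_maximal \<gamma> \<B> f x = \<infinity>" if x: "x \<in> H" for x
  proof -
    have "ereal (real m) \<le> median_maximal \<gamma> \<B> f x" for m
    proof -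
      obtain k B where k: "m \<le> k" "B \<in> \<B> x"
          "ennreal \<gamma> * emeasure lebesgue B \<le> emeasure lebesgue (E k \<inter> B)"
        using H x by meson
      have "ereal (real k) \<le> \<bar>f y\<bar>" if y: "y \<in> E k" for y
      proof -
        have "ennreal (real k powr p) = (\<Sum>j\<in>{k}. ennreal (real j powr p) * indicator (E j) y)"
          using y by simp
        also have "\<dots> \<le> g y"
          unfolding g_def by (intro sum_le_suminf) auto
        finally have "ennreal (real k) \<le> ennreal_powr (g y) (1 / p)"
          using ennreal_powr_le_iff[OF p, of "ennreal (real k)" "g y"] by (simp add: ennreal_powr_ennreal)
        then have "enn2ereal (ennreal (real k)) \<le> f y"
          unfolding f_def by (simp only: less_eq_ennreal.rep_eq)
        then show ?thesis
          by (cases "f y") auto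
      qed
      then have "ereal (real k) \<le> median_maximal \<gamma> \<B> f x"
        using k basis_set_mem_iff[OF bf] by (intro median_maximal_geI[OF bf f _ _ k(3)]) auto
      moreover have "ereal (real m) \<le> ereal (real k)"
        using k(1) by simp
      ultimately show ?thesis
        by (rule order_trans[rotated])
    qed
    then show ?thesis
      by (intro ereal_top) (meson ereal_less_eq(3) order_trans real_arch_simple)
  qed
  ultimately have "AE x in lebesgue. x \<in> H \<longrightarrow> x \<in> {}"
    by (auto elim!: eventually_mono)
  then show False
    using big[rule_format, of "{}"] by simp
qed

theorem theorem1p1:
  fixes \<B> :: "real ^ 'n \<Rightarrow> (real ^ 'n) set set"
  assumes "busemann_feller_basis \<B>"
    and "homothecy_invariant \<B>"
  shows
    "(density_basis \<B> \<longleftrightarrow>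
       (\<forall>\<gamma>::real. 0 < \<gamma> \<and> \<gamma> < 1 \<longrightarrow>
         (\<forall>f\<in>L0. AE x in lebesgue. has_basis_limit \<B> (median \<gamma> f) x (f x))))
   \<and> (density_basis \<B> \<longleftrightarrow>
       (\<forall>\<gamma>::real. 0 < \<gamma> \<and> \<gamma> < 1 \<longrightarrow>
         (\<exists>C::real. \<forall>t::real. 0 < t \<longrightarrow> (\<forall>f\<in>L0.
            emeasure lebesgue {x. median_maximal \<gamma> \<B> f x > ereal t}
              \<le> ennreal C * emeasure lebesgue {x. \<bar>f x\<bar> > ereal t}))))
   \<and> (density_basis \<B> \<longleftrightarrow>
       (\<forall>(\<gamma>::real) (p::real). 0 < \<gamma> \<and> \<gamma> < 1 \<and> 0 < p \<longrightarrow>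
         (\<exists>C::real. \<forall>f\<in>Lp p.
            Lp_norm p (median_maximal \<gamma> \<B> f) \<le> ennreal C * Lp_norm p f)))
   \<and> (density_basis \<B> \<longleftrightarrow>
       (\<exists>p::real. 0 < p \<and>
         (\<forall>(\<gamma>::real) (t::real) (f :: nat \<Rightarrow> real ^ 'n \<Rightarrow> ereal).
            0 < \<gamma> \<and> \<gamma> < 1 \<and> 0 < t \<and> (\<forall>k. f k \<in> Lp p) \<and>
            (\<lambda>k. Lp_norm p (f k)) \<longlonglongrightarrow> 0 \<longrightarrow>
            (\<lambda>k. emeasure lebesgue {x. median_maximal \<gamma> \<B> (f k) x > ereal t})
              \<longlonglongrightarrow> 0)))
   \<and> (density_basis \<B> \<longleftrightarrow>
       (\<exists>p::real. 0 < p \<and>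
         (\<forall>\<gamma>::real. 0 < \<gamma> \<and> \<gamma> < 1 \<longrightarrow>
           (\<forall>f\<in>Lp p. AE x in lebesgue. median_maximal \<gamma> \<B> f x < \<infinity>))))"
proof -
  note bf = assms(1) and hi = assms(2)
  let ?taub = "\<forall>\<gamma>. 0 < \<gamma> \<and> \<gamma> < 1 \<longrightarrow> tauberian \<B> \<gamma>"
  have dens: "density_basis \<B> \<longleftrightarrow> ?taub"
    using density_basis_imp_tauberian[OF bf hi] tauberian_imp_density_basis[OF bf] by blast
  have two: "density_basis \<B> \<longleftrightarrow>
       (\<forall>\<gamma>::real. 0 < \<gamma> \<and> \<gamma> < 1 \<longrightarrow>
         (\<forall>f\<in>L0. AE x in lebesgue. has_basis_limit \<B> (median \<gamma> f) x (f x)))"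
    using density_basis_median_tendsto[OF bf] median_tendsto_imp_density_basis[OF bf] by blast
  have three: "?taub \<longleftrightarrow>
       (\<forall>\<gamma>::real. 0 < \<gamma> \<and> \<gamma> < 1 \<longrightarrow>
         (\<exists>C::real. \<forall>t::real. 0 < t \<longrightarrow> (\<forall>f\<in>L0.
            emeasure lebesgue {x. median_maximal \<gamma> \<B> f x > ereal t}
              \<le> ennreal C * emeasure lebesgue {x. \<bar>f x\<bar> > ereal t})))" (is "_ \<longleftrightarrow> ?weak")
  proof
    assume taub: ?taub
    show ?weak
    proof (intro allI impI)
      fix \<gamma> :: real assume "0 < \<gamma> \<and> \<gamma> < 1"
      with taub have "tauberian \<B> \<gamma>"
        by blast
      then obtain C :: real where "0 < C" "\<forall>f\<in>borel_measurable lebesgue. \<forall>t::real.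
          emeasure lebesgue {x. median_maximal \<gamma> \<B> f x > ereal t}
            \<le> ennreal C * emeasure lebesgue {x. \<bar>f x\<bar> > ereal t}"
        by (rule tauberian_superlevel[OF bf])
      then show "\<exists>C::real. \<forall>t::real. 0 < t \<longrightarrow> (\<forall>f\<in>L0.
            emeasure lebesgue {x. median_maximal \<gamma> \<B> f x > ereal t}
              \<le> ennreal C * emeasure lebesgue {x. \<bar>f x\<bar> > ereal t})"
        by (intro exI[of _ C]) (simp add: L0_def)
    qed
  next
    assume weak: ?weak
    show ?taub
    proof (intro allI impI)
      fix \<gamma> :: real assume "0 < \<gamma> \<and> \<gamma> < 1"
      with weak obtain C :: real where "\<forall>t::real. 0 < t \<longrightarrow> (\<forall>f\<in>L0.
            emeasure lebesgue {x. median_maximal \<gamma> \<B> f x > ereal t}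
              \<le> ennreal C * emeasure lebesgue {x. \<bar>f x\<bar> > ereal t})"
        by blast
      then show "tauberian \<B> \<gamma>"
        by (intro weak_type_imp_tauberian[OF bf, of \<gamma> C]) auto
    qed
  qed
  have four: "\<forall>(\<gamma>::real) (p::real). 0 < \<gamma> \<and> \<gamma> < 1 \<and> 0 < p \<longrightarrow>
         (\<exists>C::real. \<forall>f\<in>Lp p.
            Lp_norm p (median_maximal \<gamma> \<B> f) \<le> ennreal C * Lp_norm p f)" (is ?strong)
    if ?taub
    using that tauberian_imp_Lp_bound[OF bf] by blast
  have five: "\<exists>p::real. 0 < p \<and>
         (\<forall>(\<gamma>::real) (t::real) (f :: nat \<Rightarrow> real ^ 'n \<Rightarrow> ereal).
            0 < \<gamma> \<and> \<gamma> < 1 \<and> 0 < t \<and> (\<forall>k. f k \<in> Lp p) \<and>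
            (\<lambda>k. Lp_norm p (f k)) \<longlonglongrightarrow> 0 \<longrightarrow>
            (\<lambda>k. emeasure lebesgue {x. median_maximal \<gamma> \<B> (f k) x > ereal t})
              \<longlonglongrightarrow> 0)" (is ?cont) if ?strong
  proof (intro exI[of _ 1] conjI allI impI)
    fix \<gamma> t :: real and f :: "nat \<Rightarrow> real ^ 'n \<Rightarrow> ereal"
    assume *: "0 < \<gamma> \<and> \<gamma> < 1 \<and> 0 < t \<and> (\<forall>k. f k \<in> Lp 1) \<and> (\<lambda>k. Lp_norm 1 (f k)) \<longlonglongrightarrow> 0"
    with that obtain C :: real where "\<forall>f\<in>Lp 1.
        Lp_norm 1 (median_maximal \<gamma> \<B> f) \<le> ennreal C * Lp_norm 1 f"
      by (meson zero_less_one)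
    with * show "(\<lambda>k. emeasure lebesgue {x. median_maximal \<gamma> \<B> (f k) x > ereal t}) \<longlonglongrightarrow> 0"
      by (intro L1_bound_imp_convergence_in_measure[OF bf, where C = C]) auto
  qed simp
  have six: "\<exists>p::real. 0 < p \<and>
         (\<forall>\<gamma>::real. 0 < \<gamma> \<and> \<gamma> < 1 \<longrightarrow>
           (\<forall>f\<in>Lp p. AE x in lebesgue. median_maximal \<gamma> \<B> f x < \<infinity>))" (is ?finite) if ?strong
  proof (intro exI[of _ 1] conjI allI impI ballI)
    fix \<gamma> :: real and f :: "real ^ 'n \<Rightarrow> ereal" assume "0 < \<gamma> \<and> \<gamma> < 1" and f: "f \<in> Lp 1"
    with that obtain C :: real where "Lp_norm 1 (median_maximal \<gamma> \<B> f) \<le> ennreal C * Lp_norm 1 f"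
      by (meson zero_less_one)
    then show "AE x in lebesgue. median_maximal \<gamma> \<B> f x < \<infinity>"
      by (rule L1_bound_imp_finite[OF bf f])
  qed simp
  have five_taub: ?taub if cont: ?cont
  proof -
    obtain p :: real where p: "0 < p" and
      *: "\<And>(\<gamma>::real) (t::real) (f :: nat \<Rightarrow> real ^ 'n \<Rightarrow> ereal).
            0 < \<gamma> \<and> \<gamma> < 1 \<and> 0 < t \<and> (\<forall>k. f k \<in> Lp p) \<and>
            (\<lambda>k. Lp_norm p (f k)) \<longlonglongrightarrow> 0 \<Longrightarrow>
            (\<lambda>k. emeasure lebesgue {x. median_maximal \<gamma> \<B> (f k) x > ereal t}) \<longlonglongrightarrow> 0"
      using cont by blast
    show ?thesis
    proof (intro allI impI)
      fix \<gamma> :: real assume \<gamma>: "0 < \<gamma> \<and> \<gamma> < 1"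
      then show "tauberian \<B> \<gamma>"
        by (intro convergence_in_measure_imp_tauberian[OF bf hi _ p] *) auto
    qed
  qed
  have six_taub: ?taub if fin: ?finite
    using fin finite_imp_tauberian[OF bf hi] by blast
  note strong = iffI[OF four five_taub[OF five]]
    and cont = iffI[OF five[OF four] five_taub]
    and finite = iffI[OF six[OF four] six_taub]
  show ?thesis
    by (rule conjI[OF two conjI[OF trans[OF dens three] conjI[OF trans[OF dens strong]
          conjI[OF trans[OF dens cont] trans[OF dens finite]]]]])
qed

end
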